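(* Let $z\in\mathbb C^n-\Delta$. Let $\tilde{\mathcal I}(z)\subset\mathcal O((\mathbb C^\times)^n)$ be the ideal generated by all polynomials $F_I(p)$ with $I\subset J$, $|I|=k-1$, and all polynomials $F_I(z,p)$ with $I\subset J$, $|I|=k+1$ (with $z$ fixed), and let $\tilde A(z)=\mathcal O((\mathbb C^\times)^n)/\tilde{\mathcal I}(z)$. Then the natural homomorphism $\tilde A(z)\to A_\Phi(z)$, $p_j\mapsto[a_j/f_j]$, $j\in J$, is an isomorphism.
   Context: Let $n>k$ be positive integers, $J=\{1,\dots,n\}$. Let $t_1,\dots,t_k$ be coordinates on $\mathbb C^k$ and $z_1,\dots,z_n$ coordinates on $\mathbb C^n$. Fix linear functions $g_j=\sum_{m=1}^k b_j^m t_m$, $j\in J$, with $b_j^m\in\mathbb C$, and put $d_{i_1,\dots,i_k}=\det_{\ell,m=1}^k(b^m_{i_\ell})$. Assume $d_{i_1,\dots,i_k}\neq0$ whenever $i_1,\dots,i_k\in J$ are distinct. Put $f_j(z,t)=z_j+g_j(t)$ on $\mathbb C^n\times\mathbb C^k$. For distinct $i_1,\dots,i_{k+1}\in J$ put $$f_{i_1,\dots,i_{k+1}}(z)=\sum_{m=1}^{k+1}(-1)^{m-1}d_{i_1,\dots,\widehat{i_m},\dots,i_{k+1}}z_{i_m},$$ and let $\Delta\subset\mathbb C^n$ be the union over all $(k+1)$-element subsets $\{i_1<\dots<i_{k+1}\}\subset J$ of the hyperplanes $f_{i_1,\dots,i_{k+1}}(z)=0$. Fix nonzero weights $a_j\in\mathbb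 C^\times$, $j\in J$, with $|a|=\sum_{j\in J}a_j\neq0$. The master function is $\Phi(z,t)=\sum_{j\in J}a_j\log f_j(z,t)$. For fixed $z$, let $U(z)=\{t\in\mathbb C^k: f_j(z,t)\neq0\ \text{for all } j\in J\}$, let $\mathcal I(z)\subset\mathcal O(U(z))$ be the ideal generated by the functions $\partial\Phi/\partial t_i=\sum_{j\in J}b_j^i a_j/f_j(z,\cdot)$, $i=1,\dots,k$, and let $A_\Phi(z)=\mathcal O(U(z))/\mathcal I(z)$. For $g\in\mathcal O(U(z))$, $[g]$ denotes its class in $A_\Phi(z)$. Let $p_1,\dots,p_n$ be the coordinates on $(\mathbb C^\times)^n$. For a subset $I=\{i_1,\dots,i_{k-1}\}$ of $k-1$ distinct elements of $J$, $F_I(p)=\sum_{j\in J}d_{j,i_1,\dots,i_{k-1}}p_j$. For a subset $I=\{i_1,\dots,i_{k+1}\}$ of $k+1$ distinct elements of $J$, $$F_I(z,p)=p_{i_1}\cdots p_{i_{k+1}}f_{i_1,\dots,i_{k+1}}(z)+\sum_{m=1}^{k+1}(-1)^m a_{i_m}d_{i_1,\dots,\widehat{i_m},\dots,i_{k+1}}\,p_{i_1}\cdots\widehat{p_{i_m}}\cdots p_{i_{k+1}}.$$ (The elements of $I$ are listed in any fixed order; changing the order changes $F_I$ at most by a sign.) $\mathcal O(X)$ denotes the algebra of regular functions on $X$. *)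

theory Defs
  imports Complex_Main "Jordan_Normal_Form.Determinant" "HOL-Algebra.QuotRing"
begin

text \<open>
  Points of affine \<open>m\<close>-space are vectors in \<open>carrier_vec m\<close>. All indices start at 0, so that
  \<open>J = {..<n}\<close>, and a sign \<open>(-1)^(m-1)\<close> at the 1-based position \<open>m\<close> of a tuple becomes
  \<open>(-1)^m\<close>.
\<close>

section \<open>Regular functions\<close>

inductive_set polynomial_functions :: "nat \<Rightarrow> (complex vec \<Rightarrow> complex) set" for m :: nat where
  const: "(\<lambda>x. c) \<in> polynomial_functions m"
| coord: "i < m \<Longrightarrow> (\<lambda>x. x $ i) \<in> polynomial_functions m"
| add: "P \<in> polynomial_functions m \<Longrightarrow> Q \<in> polynomial_functions m \<Longrightarrow>
    (\<lambda>x. P x + Q x) \<in> polynomial_functions m"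
| mult: "P \<in> polynomial_functions m \<Longrightarrow> Q \<in> polynomial_functions m \<Longrightarrow>
    (\<lambda>x. P x * Q x) \<in> polynomial_functions m"

text \<open>
  A function on \<open>X\<close> is regular if every point of \<open>X\<close> has a Zariski neighbourhood in \<open>X\<close> on which
  it is a quotient \<open>P / Q\<close> of polynomials, \<open>Q\<close> having no zero there. As the sets \<open>R \<noteq> 0\<close> form
  a basis of the Zariski topology, only neighbourhoods of this form are considered.
  Functions on \<open>X\<close> are represented by functions that are \<open>undefined\<close> outside \<open>X\<close>.
\<close>

definition regular_on :: "nat \<Rightarrow> complex vec set \<Rightarrow> (complex vec \<Rightarrow> complex) \<Rightarrow> bool" where
  "regular_on m X f \<longleftrightarrow>
    (\<forall>x\<in>X. \<exists>P\<in>polynomial_functions m. \<exists>Q\<in>polynomial_functions m. \<exists>R\<in>polynomial_functions m.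
      R x \<noteq> 0 \<and> (\<forall>y\<in>X. R y \<noteq> 0 \<longrightarrow> Q y \<noteq> 0 \<and> f y = P y / Q y))"

definition regular_ring :: "nat \<Rightarrow> complex vec set \<Rightarrow> (complex vec \<Rightarrow> complex) ring" where
  "regular_ring m X =
    \<lparr>carrier = {f \<in> extensional X. regular_on m X f},
     monoid.mult = (\<lambda>f g. \<lambda>x\<in>X. f x * g x),
     one = (\<lambda>x\<in>X. 1),
     zero = (\<lambda>x\<in>X. 0),
     add = (\<lambda>f g. \<lambda>x\<in>X. f x + g x)\<rparr>"


section \<open>The arrangement\<close>

text \<open>
  The coefficient \<open>b\<^sub>j\<^sup>m\<close> is written \<open>b j m\<close>. Tuples of indices are lists; \<open>omit m is\<close>
  is the tuple with the hat over position \<open>m\<close>.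
\<close>

definition omit :: "nat \<Rightarrow> nat list \<Rightarrow> nat list" where
  "omit m is = take m is @ drop (Suc m) is"

definition d_minor :: "nat \<Rightarrow> (nat \<Rightarrow> nat \<Rightarrow> complex) \<Rightarrow> nat list \<Rightarrow> complex" where
  "d_minor k b is = det (mat k k (\<lambda>(l, m). b (is ! l) m))"

definition g_lin :: "nat \<Rightarrow> (nat \<Rightarrow> nat \<Rightarrow> complex) \<Rightarrow> nat \<Rightarrow> complex vec \<Rightarrow> complex" where
  "g_lin k b j t = (\<Sum>m<k. b j m * t $ m)"

definition f_lin :: "nat \<Rightarrow> (nat \<Rightarrow> nat \<Rightarrow> complex) \<Rightarrow> nat \<Rightarrow> complex vec \<Rightarrow> complex vec \<Rightarrow> complex" where
  "f_lin k b j z t = z $ j + g_lin k b j t"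

definition f_circuit :: "nat \<Rightarrow> (nat \<Rightarrow> nat \<Rightarrow> complex) \<Rightarrow> nat list \<Rightarrow> complex vec \<Rightarrow> complex" where
  "f_circuit k b is z = (\<Sum>m<k+1. (-1) ^ m * d_minor k b (omit m is) * z $ (is ! m))"

definition Discr :: "nat \<Rightarrow> nat \<Rightarrow> (nat \<Rightarrow> nat \<Rightarrow> complex) \<Rightarrow> complex vec set" where
  "Discr k n b = {z \<in> carrier_vec n.
    \<exists>I \<subseteq> {..<n}. card I = k + 1 \<and> f_circuit k b (sorted_list_of_set I) z = 0}"


section \<open>The algebra of functions on the critical set of the master function\<close>

definition U_compl :: "nat \<Rightarrow> nat \<Rightarrow> (nat \<Rightarrow> nat \<Rightarrow> complex) \<Rightarrow> complex vec \<Rightarrow> complex vec set" where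
  "U_compl k n b z = {t \<in> carrier_vec k. \<forall>j<n. f_lin k b j z t \<noteq> 0}"

definition dPhi :: "nat \<Rightarrow> nat \<Rightarrow> (nat \<Rightarrow> complex) \<Rightarrow> (nat \<Rightarrow> nat \<Rightarrow> complex) \<Rightarrow> complex vec
    \<Rightarrow> nat \<Rightarrow> complex vec \<Rightarrow> complex" where
  "dPhi k n a b z i t = (\<Sum>j<n. b j i * a j / f_lin k b j z t)"

text \<open>
  \<open>dPhi\<close> is the partial derivative of the multivalued function \<open>\<Sum> a\<^sub>j log f\<^sub>j\<close>, whichever
  branches \<open>L j\<close> of \<open>log f\<^sub>j\<close> are chosen locally.
\<close>

lemma dPhi_is_partial_derivative:
  assumes i: "i < k" and t: "t \<in> U_compl k n b z"
    and L: "\<And>j. j < n \<Longrightarrow> (L j has_field_derivative L' j) (at 0)"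
    and branch: "\<And>j. j < n \<Longrightarrow>
      eventually (\<lambda>s. exp (L j s) = f_lin k b j z (t + s \<cdot>\<^sub>v unit_vec k i)) (nhds 0)"
  shows "((\<lambda>s. \<Sum>j<n. a j * L j s) has_field_derivative dPhi k n a b z i t) (at 0)"
proof -
  have tk: "t \<in> carrier_vec k" using t by (simp add: U_compl_def)
  have f_line: "f_lin k b j z (t + s \<cdot>\<^sub>v unit_vec k i) = f_lin k b j z t + b j i * s" for j s
  proof -
    have "(\<Sum>m<k. b j m * (t + s \<cdot>\<^sub>v unit_vec k i) $ m)
        = (\<Sum>m<k. b j m * t $ m + (if m = i then b j i * s else 0))"
      by (rule sum.cong) (use tk i in \<open>auto simp: algebra_simps\<close>)
    also have "\<dots> = (\<Sum>m<k. b j m * t $ m) + b j i * s"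
      using i by (simp add: sum.distrib)
    finally show ?thesis by (simp add: f_lin_def g_lin_def)
  qed
  have L': "L' j = b j i / f_lin k b j z t" if j: "j < n" for j
  proof -
    have f0: "f_lin k b j z t \<noteq> 0" using t j by (simp add: U_compl_def)
    have ev: "eventually (\<lambda>s. exp (L j s) = f_lin k b j z t + b j i * s) (nhds 0)"
      using branch[OF j] by (simp add: f_line)
    have e0: "exp (L j 0) = f_lin k b j z t"
      using eventually_nhds_x_imp_x[OF ev] by simp
    have "((\<lambda>s. exp (L j s)) has_field_derivative exp (L j 0) * L' j) (at 0)"
      using DERIV_chain2[OF DERIV_exp L[OF j]] .
    then have "((\<lambda>s. f_lin k b j z t + b j i * s) has_field_derivative exp (L j 0) * L' j) (at 0)"
      using DERIV_cong_ev[OF refl ev refl] by blast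
    moreover have "((\<lambda>s. f_lin k b j z t + b j i * s) has_field_derivative b j i) (at 0)"
      by (auto intro!: derivative_eq_intros)
    ultimately have "exp (L j 0) * L' j = b j i" by (rule DERIV_unique)
    then show ?thesis using f0 e0 by (simp add: field_simps)
  qed
  have "((\<lambda>s. \<Sum>j<n. a j * L j s) has_field_derivative (\<Sum>j<n. a j * L' j)) (at 0)"
    by (rule DERIV_sum) (auto intro!: DERIV_cmult L)
  also have "(\<Sum>j<n. a j * L' j) = dPhi k n a b z i t"
    unfolding dPhi_def by (rule sum.cong) (auto simp: L')
  finally show ?thesis .
qed

definition O_U :: "nat \<Rightarrow> nat \<Rightarrow> (nat \<Rightarrow> nat \<Rightarrow> complex) \<Rightarrow> complex vec
    \<Rightarrow> (complex vec \<Rightarrow> complex) ring" where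
  "O_U k n b z = regular_ring k (U_compl k n b z)"

definition I_Phi :: "nat \<Rightarrow> nat \<Rightarrow> (nat \<Rightarrow> complex) \<Rightarrow> (nat \<Rightarrow> nat \<Rightarrow> complex) \<Rightarrow> complex vec
    \<Rightarrow> (complex vec \<Rightarrow> complex) set" where
  "I_Phi k n a b z = genideal (O_U k n b z) {restrict (dPhi k n a b z i) (U_compl k n b z) |i. i < k}"

definition A_Phi :: "nat \<Rightarrow> nat \<Rightarrow> (nat \<Rightarrow> complex) \<Rightarrow> (nat \<Rightarrow> nat \<Rightarrow> complex) \<Rightarrow> complex vec
    \<Rightarrow> (complex vec \<Rightarrow> complex) set ring" where
  "A_Phi k n a b z = O_U k n b z Quot I_Phi k n a b z"

definition class_Phi :: "nat \<Rightarrow> nat \<Rightarrow> (nat \<Rightarrow> complex) \<Rightarrow> (nat \<Rightarrow> nat \<Rightarrow> complex) \<Rightarrow> complex vec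
    \<Rightarrow> (complex vec \<Rightarrow> complex) \<Rightarrow> (complex vec \<Rightarrow> complex) set" where
  "class_Phi k n a b z g = I_Phi k n a b z +>\<^bsub>O_U k n b z\<^esub> restrict g (U_compl k n b z)"


section \<open>The quotient of the algebra of functions on the torus\<close>

definition torus :: "nat \<Rightarrow> complex vec set" where
  "torus n = {p \<in> carrier_vec n. \<forall>j<n. p $ j \<noteq> 0}"

definition F_small :: "nat \<Rightarrow> nat \<Rightarrow> (nat \<Rightarrow> nat \<Rightarrow> complex) \<Rightarrow> nat list \<Rightarrow> complex vec \<Rightarrow> complex" where
  "F_small k n b is p = (\<Sum>j<n. d_minor k b (j # is) * p $ j)"

definition F_large :: "nat \<Rightarrow> (nat \<Rightarrow> complex) \<Rightarrow> (nat \<Rightarrow> nat \<Rightarrow> complex) \<Rightarrow> nat list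
    \<Rightarrow> complex vec \<Rightarrow> complex vec \<Rightarrow> complex" where
  "F_large k a b is z p =
    (\<Prod>m<k+1. p $ (is ! m)) * f_circuit k b is z
    + (\<Sum>m<k+1. (-1) ^ (m + 1) * a (is ! m) * d_minor k b (omit m is)
        * (\<Prod>l\<in>{..<k+1} - {m}. p $ (is ! l)))"

definition O_torus :: "nat \<Rightarrow> (complex vec \<Rightarrow> complex) ring" where
  "O_torus n = regular_ring n (torus n)"

definition I_tilde :: "nat \<Rightarrow> nat \<Rightarrow> (nat \<Rightarrow> complex) \<Rightarrow> (nat \<Rightarrow> nat \<Rightarrow> complex) \<Rightarrow> complex vec
    \<Rightarrow> (complex vec \<Rightarrow> complex) set" where
  "I_tilde k n a b z = genideal (O_torus n)
    ({restrict (F_small k n b (sorted_list_of_set I)) (torus n) |I. I \<subseteq> {..<n} \<and> card I = k - 1}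
     \<union> {restrict (F_large k a b (sorted_list_of_set I) z) (torus n) |I. I \<subseteq> {..<n} \<and> card I = k + 1})"

definition A_tilde :: "nat \<Rightarrow> nat \<Rightarrow> (nat \<Rightarrow> complex) \<Rightarrow> (nat \<Rightarrow> nat \<Rightarrow> complex) \<Rightarrow> complex vec
    \<Rightarrow> (complex vec \<Rightarrow> complex) set ring" where
  "A_tilde k n a b z = O_torus n Quot I_tilde k n a b z"

definition class_tilde :: "nat \<Rightarrow> nat \<Rightarrow> (nat \<Rightarrow> complex) \<Rightarrow> (nat \<Rightarrow> nat \<Rightarrow> complex) \<Rightarrow> complex vec
    \<Rightarrow> (complex vec \<Rightarrow> complex) \<Rightarrow> (complex vec \<Rightarrow> complex) set" where
  "class_tilde k n a b z g = I_tilde k n a b z +>\<^bsub>O_torus n\<^esub> restrict g (torus n)"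

text \<open>
  A homomorphism of \<open>\<complex>\<close>-algebras is a ring homomorphism compatible with the
  classes of the constant functions.
\<close>

definition natural_hom :: "nat \<Rightarrow> nat \<Rightarrow> (nat \<Rightarrow> complex) \<Rightarrow> (nat \<Rightarrow> nat \<Rightarrow> complex) \<Rightarrow> complex vec
    \<Rightarrow> ((complex vec \<Rightarrow> complex) set \<Rightarrow> (complex vec \<Rightarrow> complex) set) \<Rightarrow> bool" where
  "natural_hom k n a b z h \<longleftrightarrow>
    h \<in> ring_hom (A_tilde k n a b z) (A_Phi k n a b z)
    \<and> (\<forall>c. h (class_tilde k n a b z (\<lambda>p. c)) = class_Phi k n a b z (\<lambda>t. c))
    \<and> (\<forall>j<n. h (class_tilde k n a b z (\<lambda>p. p $ j))
              = class_Phi k n a b z (\<lambda>t. a j / f_lin k b j z t))"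

end

theory Submission
  imports Defs "HOL-Library.Function_Algebras" "HOL-Analysis.Continuum_Not_Denumerable"
    "HOL-Computational_Algebra.Fundamental_Theorem_Algebra"
begin

text \<open>
  The substitution \<open>p\<^sub>j = a\<^sub>j / f\<^sub>j(z, t)\<close> is a map \<open>\<alpha>\<close> from the complement \<open>U\<close> of the arrangement to
  the torus, and the natural homomorphism is induced by pullback along \<open>\<alpha>\<close>. Everything follows from
  three facts about this pullback.

  It is surjective: \<open>\<alpha>\<close> has a left inverse \<open>\<beta>\<close>, regular on the torus, because \<open>t\<close> is recovered
  linearly from \<open>f\<^sub>j(z, t) = a\<^sub>j / p\<^sub>j\<close> for the first \<open>k\<close> indices \<open>j\<close> (\<open>pullback_surj\<close>).

  It carries the ideal on the torus onto the ideal on \<open>U\<close> (\<open>pullback_I_tilde\<close>). The partial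
  derivatives of the master function are pullbacks of linear forms in \<open>p\<close>, of which the \<open>F\<^sub>I\<close> with
  \<open>|I| = k - 1\<close> are combinations by Laplace expansion, and conversely by Cramer's rule. The \<open>F\<^sub>I\<close>
  with \<open>|I| = k + 1\<close> have pullback zero, for they are, with denominators cleared, the linear relations
  between the \<open>f\<^sub>j(z, t)\<close>, rewritten in \<open>a\<^sub>j / p\<^sub>j\<close> (\<open>circuit_sum_f_lin\<close>, \<open>F_large_eq\<close>).

  Its kernel lies in the ideal on the torus (\<open>kernel_pullback_subset\<close>). The relations just mentioned
  say that \<open>a\<^sub>j / p\<^sub>j\<close> is congruent to \<open>f\<^sub>j(z, \<beta>(p))\<close>, so that up to a unit every regular function on the torus
  is congruent to \<open>Q(\<beta>(p))\<close> for a polynomial \<open>Q\<close>, and its pullback determines \<open>Q\<close> on \<open>U\<close>.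

  These arguments need regular functions, which are fractions only locally, to be polynomials in the
  coordinates and the inverses of the functions that define the open set
  (\<open>regular_on_nonvanishing_locus\<close>). This rests on a Nullstellensatz for finitely generated complex
  algebras of functions (\<open>proper_ideal_in_codim_one_ideal\<close>), which is proved by comparing their
  countable dimension with the uncountably many complex numbers. The same description of regular
  functions shows that the natural homomorphism is unique.
\<close>

section \<open>A Nullstellensatz for finitely generated algebras of functions\<close>

inductive_set fun_alg :: "('x \<Rightarrow> complex) set \<Rightarrow> ('x \<Rightarrow> complex) set" for E where
  const: "(\<lambda>x. c) \<in> fun_alg E"
| gen: "e \<in> E \<Longrightarrow> e \<in> fun_alg E"
| add: "f \<in> fun_alg E \<Longrightarrow> g \<in> fun_alg E \<Longrightarrow> (\<lambda>x. f x + g x) \<in> fun_alg E"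
| mult: "f \<in> fun_alg E \<Longrightarrow> g \<in> fun_alg E \<Longrightarrow> (\<lambda>x. f x * g x) \<in> fun_alg E"

lemma fun_alg_cmult: "f \<in> fun_alg E \<Longrightarrow> (\<lambda>x. c * f x) \<in> fun_alg E"
  by (rule fun_alg.mult[OF fun_alg.const])

lemma fun_alg_diff: "f \<in> fun_alg E \<Longrightarrow> g \<in> fun_alg E \<Longrightarrow> (\<lambda>x. f x - g x) \<in> fun_alg E"
  using fun_alg.add[OF _ fun_alg_cmult[of g E "-1"], of f] by simp

lemma fun_alg_prod:
  "(\<And>i. i \<in> A \<Longrightarrow> f i \<in> fun_alg E) \<Longrightarrow> (\<lambda>x. \<Prod>i\<in>A. f i x) \<in> fun_alg E"
  by (induction A rule: infinite_finite_induct) (auto intro: fun_alg.const fun_alg.mult)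

lemma fun_alg_poly: "g \<in> fun_alg E \<Longrightarrow> (\<lambda>x. poly p (g x)) \<in> fun_alg E"
  by (induction p) (auto intro: fun_alg.const fun_alg.mult fun_alg.add)

text \<open>
  Ideals are plain sets of functions. To compare functions on a subset only, one takes an ideal that
  contains all functions vanishing on that subset, so that values elsewhere are forgotten.
\<close>

definition fun_ideal :: "('x \<Rightarrow> complex) set \<Rightarrow> ('x \<Rightarrow> complex) set \<Rightarrow> bool" where
  "fun_ideal A I \<longleftrightarrow> I \<subseteq> A \<and> (\<lambda>x. 0) \<in> I \<and> (\<forall>f\<in>I. \<forall>g\<in>I. (\<lambda>x. f x + g x) \<in> I)
    \<and> (\<forall>f\<in>A. \<forall>g\<in>I. (\<lambda>x. f x * g x) \<in> I)"

lemma
  assumes "fun_ideal A I"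
  shows fun_ideal_subset: "f \<in> I \<Longrightarrow> f \<in> A"
    and fun_ideal_zero: "(\<lambda>x. 0) \<in> I"
    and fun_ideal_add: "f \<in> I \<Longrightarrow> g \<in> I \<Longrightarrow> (\<lambda>x. f x + g x) \<in> I"
    and fun_ideal_mult: "f \<in> A \<Longrightarrow> g \<in> I \<Longrightarrow> (\<lambda>x. f x * g x) \<in> I"
  using assms by (auto simp: fun_ideal_def)

lemma fun_ideal_diff:
  "fun_ideal (fun_alg E) I \<Longrightarrow> f \<in> I \<Longrightarrow> g \<in> I \<Longrightarrow> (\<lambda>x. f x - g x) \<in> I"
  using fun_ideal_add[of "fun_alg E" I f, OF _ _ fun_ideal_mult[of "fun_alg E" I _ g, OF _ fun_alg.const[of "-1"]]]
  by simp

lemma fun_ideal_sum: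
  assumes "fun_ideal A I"
  shows "(\<And>i. i \<in> S \<Longrightarrow> f i \<in> I) \<Longrightarrow> (\<lambda>x. \<Sum>i\<in>S. f i x) \<in> I"
  by (induction S rule: infinite_finite_induct)
    (auto intro: fun_ideal_zero[OF assms] fun_ideal_add[OF assms])

interpretation fun_vs: vector_space "\<lambda>c f. (\<lambda>x. c * f x) :: 'x \<Rightarrow> complex"
  by unfold_locales (auto simp: fun_eq_iff algebra_simps)

text \<open>
  Products of words in the generators are again words, so words span the algebra. For countable
  \<open>E\<close> there are only countably many words.
\<close>

lemma fun_alg_subset_span_words:
  "fun_alg E \<subseteq> fun_vs.span ((\<lambda>w x. \<Prod>e\<leftarrow>w. e x) ` lists E)" (is "_ \<subseteq> fun_vs.span ?W")
proof
  fix f assume "f \<in> fun_alg E"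
  then show "f \<in> fun_vs.span ?W"
  proof induction
    case (const c)
    have "(\<lambda>x. 1) \<in> ?W" by (rule image_eqI[of _ _ "[]"]) auto
    from fun_vs.span_scale[OF fun_vs.span_base[OF this], of c] show ?case by simp
  next
    case (gen e)
    have "e \<in> ?W" by (rule image_eqI[of _ _ "[e]"]) (use gen in auto)
    then show ?case by (rule fun_vs.span_base)
  next
    case (add f g)
    from fun_vs.span_add[OF add.IH] show ?case by (simp add: plus_fun_def)
  next
    case (mult f g)
    have word: "(\<lambda>x. v x * h x) \<in> fun_vs.span ?W" if "v \<in> ?W" "h \<in> fun_vs.span ?W" for v h
      using that(2)
    proof (induction rule: fun_vs.span_induct_alt)
      case base
      show ?case using fun_vs.span_zero[of ?W] by (simp add: zero_fun_def)
    next
      case (step c u h)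
      from step.hyps that(1) obtain r s where "r \<in> lists E" "s \<in> lists E"
        "v = (\<lambda>x. \<Prod>e\<leftarrow>r. e x)" "u = (\<lambda>x. \<Prod>e\<leftarrow>s. e x)" by auto
      then have "(\<lambda>x. v x * u x) \<in> ?W"
        by (intro image_eqI[of _ _ "r @ s"]) auto
      from fun_vs.span_add[OF fun_vs.span_scale[OF fun_vs.span_base[OF this], of c] step.IH]
      show ?case by (simp add: plus_fun_def algebra_simps)
    qed
    from mult.IH(1) show ?case
    proof (induction rule: fun_vs.span_induct_alt)
      case base
      show ?case using fun_vs.span_zero[of ?W] by (simp add: zero_fun_def)
    next
      case (step c u h)
      from fun_vs.span_add[OF fun_vs.span_scale[OF word[OF step.hyps mult.IH(2)], of c] step.IH]
      show ?case by (simp add: plus_fun_def algebra_simps)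
    qed
  qed
qed

lemma sum_fun_pointwise: "(\<Sum>i\<in>A. f i) x = (\<Sum>i\<in>A. f i x :: 'b :: comm_monoid_add)"
  by (induction A rule: infinite_finite_induct) auto

text \<open>
  There are uncountably many indices but only countably many finite sets of words, so infinitely
  many \<open>h c\<close> lie in the span of one and the same finite set.
\<close>

lemma fun_alg_family_dependent:
  fixes h :: "complex \<Rightarrow> 'x \<Rightarrow> complex"
  assumes "countable E" "\<And>c. h c \<in> fun_alg E"
  obtains C l where "finite C" "\<exists>c\<in>C. l c \<noteq> 0" "\<And>x. (\<Sum>c\<in>C. l c * h c x) = 0"
proof -
  define W :: "('x \<Rightarrow> complex) set" where "W = (\<lambda>w x. \<Prod>e\<leftarrow>w. e x) ` lists E"
  have "countable W" using assms(1) by (simp add: W_def)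
  have "\<forall>c. \<exists>F. finite F \<and> F \<subseteq> W \<and> h c \<in> fun_vs.span F"
  proof
    fix c
    have "h c \<in> fun_vs.span W" using assms(2) fun_alg_subset_span_words W_def by blast
    then obtain F r where "h c = (\<Sum>a\<in>F. (\<lambda>x. r a * a x))" "finite F" "F \<subseteq> W"
      unfolding fun_vs.span_explicit mem_Collect_eq by (elim exE conjE) (rule that)
    moreover have "(\<Sum>a\<in>F. (\<lambda>x. r a * a x)) \<in> fun_vs.span F"
      by (intro fun_vs.span_sum fun_vs.span_scale fun_vs.span_base)
    ultimately show "\<exists>F. finite F \<and> F \<subseteq> W \<and> h c \<in> fun_vs.span F" by (intro exI[of _ F]) simp
  qed
  then obtain F where F: "\<And>c. finite (F c)" "\<And>c. F c \<subseteq> W" "\<And>c. h c \<in> fun_vs.span (F c)"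
    unfolding choice_iff by blast
  have "countable (range F)"
    by (rule countable_subset[OF _ countable_Collect_finite_subset[OF \<open>countable W\<close>]]) (use F in auto)
  have "\<exists>G. infinite {c. F c = G}"
  proof (rule ccontr)
    assume *: "\<nexists>G. infinite {c. F c = G}"
    have "UNIV = (\<Union>G\<in>range F. {c. F c = G})" by auto
    moreover have "countable \<dots>"
      using * by (intro countable_UN[OF \<open>countable (range F)\<close>]) (auto intro: countable_finite)
    ultimately show False using uncountable_UNIV_complex by simp
  qed
  then obtain G where G: "infinite {c. F c = G}" by blast
  obtain C where C: "finite C" "card C = Suc (card G)" "C \<subseteq> {c. F c = G}"
    using infinite_arbitrarily_large[OF G, of "Suc (card G)"] by blast
  then obtain c where "F c = G" by fastforce
  then have "finite G" using F(1)[of c] by simp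
  show thesis
  proof (cases "inj_on h C")
    case False
    then obtain c c' where cc: "c \<in> C" "c' \<in> C" "c \<noteq> c'" "h c = h c'" by (auto simp: inj_on_def)
    define l :: "complex \<Rightarrow> complex" where "l = (\<lambda>_. 0)(c := 1, c' := -1)"
    show thesis by (rule that[of "{c, c'}" l]) (use cc in \<open>auto simp: l_def\<close>)
  next
    case True
    have "h ` C \<subseteq> fun_vs.span G" using F(3) C by auto
    moreover have "card (h ` C) = Suc (card G)" using True C by (simp add: card_image)
    ultimately have dep: "fun_vs.dependent (h ` C)"
      using fun_vs.independent_span_bound[OF \<open>finite G\<close>, of "h ` C"] by linarith
    have "finite (h ` C)" using C by simp
    note dep_iff = fun_vs.dependent_finite[OF this]
    from dep obtain u where
      u: "\<exists>v\<in>h ` C. u v \<noteq> 0" "(\<Sum>v\<in>h ` C. (\<lambda>x. u v * v x)) = 0"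
      unfolding dep_iff by (elim exE conjE) (rule that)
    have "(\<Sum>c\<in>C. u (h c) * h c x) = 0" for x
    proof -
      have "(\<Sum>c\<in>C. u (h c) * h c x) = (\<Sum>v\<in>h ` C. u v * v x)"
        using True by (simp add: sum.reindex)
      also have "\<dots> = (\<Sum>v\<in>h ` C. (\<lambda>x. u v * v x)) x"
        by (simp add: sum_fun_pointwise)
      also have "\<dots> = 0" using u(2) by simp
      finally show ?thesis .
    qed
    then show thesis using that[of C "\<lambda>c. u (h c)"] u(1) C(1) by auto
  qed
qed

text \<open>
  Some \<open>g - c\<close> is not invertible modulo \<open>I\<close>. Otherwise the inverses \<open>h c\<close> satisfy a linear relation
  by countability; multiplied by the product of all \<open>g - c\<close> involved, it says that a nonzero polynomial
  in \<open>g\<close> lies in \<open>I\<close>. Over the complex numbers it splits into factors \<open>g - r\<close>, each invertible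
  modulo \<open>I\<close>, so \<open>I\<close> would contain \<open>1\<close>.
\<close>

lemma proper_ideal_adjoin_constant:
  fixes g :: "'x \<Rightarrow> complex"
  assumes E: "countable E" and I: "fun_ideal (fun_alg E) I" and proper: "(\<lambda>x. 1) \<notin> I"
    and g: "g \<in> fun_alg E"
  shows "\<exists>c. \<forall>h\<in>fun_alg E. (\<lambda>x. 1 - h x * (g x - c)) \<notin> I"
proof (rule ccontr)
  assume "\<not> ?thesis"
  then have "\<forall>c. \<exists>h. h \<in> fun_alg E \<and> (\<lambda>x. 1 - h x * (g x - c)) \<in> I" by blast
  then obtain h where h: "\<And>c. h c \<in> fun_alg E" "\<And>c. (\<lambda>x. 1 - h c x * (g x - c)) \<in> I"
    unfolding choice_iff by blast
  obtain C l where C: "finite C" "\<exists>c\<in>C. l c \<noteq> 0" "\<And>x. (\<Sum>c\<in>C. l c * h c x) = 0"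
    using fun_alg_family_dependent[where h = h, OF E h(1)] by blast
  define q where "q = (\<Sum>c\<in>C. smult (l c) (\<Prod>d\<in>C - {c}. [:-d, 1:]))"
  have poly_q: "poly q y = (\<Sum>c\<in>C. l c * (\<Prod>d\<in>C - {c}. y - d))" for y
    by (simp add: q_def poly_sum poly_prod)
  from C(2) obtain c where c: "c \<in> C" "l c \<noteq> 0" by blast
  \<comment> \<open>At \<open>c\<close> only the summand of \<open>c\<close> itself survives.\<close>
  have "poly q c = (\<Sum>e\<in>C. if e = c then l c * (\<Prod>d\<in>C - {c}. c - d) else 0)"
    unfolding poly_q using C(1) c by (intro sum.cong) auto
  also have "\<dots> = l c * (\<Prod>d\<in>C - {c}. c - d)" using C(1) c by simp
  also have "\<dots> \<noteq> 0" using C(1) c by auto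
  finally have "q \<noteq> 0" by auto
  \<comment> \<open>Multiplying the dependency by the product of all \<open>g - c\<close> turns each \<open>h c\<close> into a product of
    the other factors.\<close>
  have "(\<lambda>x. \<Sum>c\<in>C. (l c * (\<Prod>d\<in>C - {c}. g x - d)) * (1 - h c x * (g x - c))) \<in> I"
    by (intro fun_ideal_sum[OF I] fun_ideal_mult[OF I] h fun_alg_cmult fun_alg_prod fun_alg_diff
        g fun_alg.const)
  also have "(\<lambda>x. \<Sum>c\<in>C. (l c * (\<Prod>d\<in>C - {c}. g x - d)) * (1 - h c x * (g x - c)))
      = (\<lambda>x. poly q (g x))"
  proof
    fix x
    have expand: "u * p * (1 - v * y) = u * p - (y * p) * (u * v)" for u v p y :: complex
      by (simp add: algebra_simps)
    have "(\<Sum>c\<in>C. (l c * (\<Prod>d\<in>C - {c}. g x - d)) * (1 - h c x * (g x - c)))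
      = (\<Sum>c\<in>C. l c * (\<Prod>d\<in>C - {c}. g x - d) - (\<Prod>d\<in>C. g x - d) * (l c * h c x))"
    proof (rule sum.cong[OF refl])
      fix c assume "c \<in> C"
      then have "(\<Prod>d\<in>C. g x - d) = (g x - c) * (\<Prod>d\<in>C - {c}. g x - d)"
        using C(1) by (rule prod.remove[rotated])
      then show "(l c * (\<Prod>d\<in>C - {c}. g x - d)) * (1 - h c x * (g x - c))
        = l c * (\<Prod>d\<in>C - {c}. g x - d) - (\<Prod>d\<in>C. g x - d) * (l c * h c x)"
        by (simp only: expand)
    qed
    also have "\<dots> = poly q (g x) - (\<Prod>d\<in>C. g x - d) * (\<Sum>c\<in>C. l c * h c x)"
      by (simp add: sum_subtractf poly_q sum_distrib_left)
    finally show "(\<Sum>c\<in>C. (l c * (\<Prod>d\<in>C - {c}. g x - d)) * (1 - h c x * (g x - c)))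
      = poly q (g x)" by (simp add: C(3))
  qed
  finally have q: "(\<lambda>x. poly q (g x)) \<in> I" .
  have "p \<noteq> 0 \<Longrightarrow> (\<lambda>x. poly p (g x)) \<notin> I" for p
  proof (induction "degree p" arbitrary: p)
    case 0
    then obtain e where "p = [:e:]" "e \<noteq> 0" by (metis degree_eq_zeroE pCons_0_0)
    then show ?case
      using fun_ideal_mult[OF I fun_alg.const[of "inverse e"], of "\<lambda>x. e"] proper by auto
  next
    case (Suc m)
    then obtain r where "poly p r = 0"
      using fundamental_theorem_of_algebra by (metis constant_degree nat.distinct(1))
    then obtain p' where p': "p = [:-r, 1:] * p'" by (metis dvdE poly_eq_0_iff_dvd)
    with Suc.prems have "p' \<noteq> 0" by auto
    then have "degree p = degree [:-r, 1:] + degree p'"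
      unfolding p' by (intro degree_mult_eq) auto
    then have p'_notin: "(\<lambda>x. poly p' (g x)) \<notin> I" using Suc.hyps \<open>p' \<noteq> 0\<close> by simp
    show ?case
    proof
      assume "(\<lambda>x. poly p (g x)) \<in> I"
      from fun_ideal_add[OF I fun_ideal_mult[OF I h(1)[of r] this]
          fun_ideal_mult[OF I fun_alg_poly[OF g, of p'] h(2)[of r]]]
      have "(\<lambda>x. poly p' (g x)) \<in> I" by (simp add: p' algebra_simps)
      with p'_notin show False ..
    qed
  qed
  from this[OF \<open>q \<noteq> 0\<close>] q show False ..
qed

lemma fun_ideal_adjoin:
  assumes I: "fun_ideal (fun_alg E) I" and g: "g \<in> fun_alg E"
  defines "I' \<equiv> {\<lambda>x. i x + h x * g x | i h. i \<in> I \<and> h \<in> fun_alg E}"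
  shows "fun_ideal (fun_alg E) I'" "I \<subseteq> I'" "g \<in> I'"
proof -
  have mem: "f \<in> I'" if "i \<in> I" "h \<in> fun_alg E" "\<And>x. f x = i x + h x * g x" for f i h
  proof -
    have "f = (\<lambda>x. i x + h x * g x)" using that(3) by auto
    then show ?thesis using that(1,2) I'_def by blast
  qed
  show "I \<subseteq> I'"
  proof
    fix f assume "f \<in> I"
    then show "f \<in> I'" by (rule mem[OF _ fun_alg.const[of 0]]) simp
  qed
  show "g \<in> I'" by (rule mem[OF fun_ideal_zero[OF I] fun_alg.const[of 1]]) simp
  show "fun_ideal (fun_alg E) I'"
    unfolding fun_ideal_def
  proof (intro conjI ballI)
    show "I' \<subseteq> fun_alg E"
      unfolding I'_def by (auto intro!: fun_alg.add fun_alg.mult[OF _ g] intro: fun_ideal_subset[OF I])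
    show "(\<lambda>x. 0) \<in> I'" using \<open>I \<subseteq> I'\<close> fun_ideal_zero[OF I] by blast
  next
    fix f f' assume "f \<in> I'" "f' \<in> I'"
    then obtain i h i' h' where *: "i \<in> I" "i' \<in> I" "h \<in> fun_alg E" "h' \<in> fun_alg E"
      "f = (\<lambda>x. i x + h x * g x)" "f' = (\<lambda>x. i' x + h' x * g x)" unfolding I'_def by blast
    show "(\<lambda>x. f x + f' x) \<in> I'"
      by (rule mem[OF fun_ideal_add[OF I *(1,2)] fun_alg.add[OF *(3,4)]])
        (simp add: * algebra_simps)
  next
    fix f f' assume "f \<in> fun_alg E" "f' \<in> I'"
    then obtain i h where *: "i \<in> I" "h \<in> fun_alg E" "f' = (\<lambda>x. i x + h x * g x)"
      unfolding I'_def by blast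
    show "(\<lambda>x. f x * f' x) \<in> I'"
      by (rule mem[OF fun_ideal_mult[OF I \<open>f \<in> _\<close> *(1)] fun_alg.mult[OF \<open>f \<in> _\<close> *(2)]])
        (simp add: * algebra_simps)
  qed
qed

definition const_mod :: "('x \<Rightarrow> complex) set \<Rightarrow> ('x \<Rightarrow> complex) \<Rightarrow> bool" where
  "const_mod M g \<longleftrightarrow> (\<exists>c. (\<lambda>x. g x - c) \<in> M)"

text \<open>
  The weak Nullstellensatz. Adjoining \<open>g - c\<close> for one generator \<open>g\<close> after the other keeps the ideal
  proper for suitable constants \<open>c\<close>, and once all generators are constant modulo \<open>M\<close>, so is
  everything else. Thus \<open>M\<close> is the kernel of a character of the algebra.
\<close>

theorem proper_ideal_in_codim_one_ideal:
  assumes E: "finite E" and I: "fun_ideal (fun_alg E) I" and proper: "(\<lambda>x. 1) \<notin> I"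
  obtains M where "fun_ideal (fun_alg E) M" "I \<subseteq> M" "(\<lambda>x. 1) \<notin> M"
    "\<And>g. g \<in> fun_alg E \<Longrightarrow> const_mod M g"
proof -
  have "\<exists>M. fun_ideal (fun_alg E) M \<and> I \<subseteq> M \<and> (\<lambda>x. 1) \<notin> M \<and> (\<forall>e\<in>F. const_mod M e)"
    if "finite F" "F \<subseteq> E" for F
    using that
  proof (induction F)
    case empty
    then show ?case using I proper by auto
  next
    case (insert g F)
    then obtain M where M: "fun_ideal (fun_alg E) M" "I \<subseteq> M" "(\<lambda>x. 1) \<notin> M"
      "\<forall>e\<in>F. const_mod M e" by auto
    have g: "g \<in> fun_alg E" using insert.prems by (auto intro: fun_alg.gen)
    obtain c where c: "\<forall>h\<in>fun_alg E. (\<lambda>x. 1 - h x * (g x - c)) \<notin> M"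
      using proper_ideal_adjoin_constant[OF countable_finite[OF E] M(1,3) g] by blast
    have gc: "(\<lambda>x. g x - c) \<in> fun_alg E" by (intro fun_alg_diff g fun_alg.const)
    define M' where "M' = {\<lambda>x. i x + h x * (g x - c) | i h. i \<in> M \<and> h \<in> fun_alg E}"
    note M' = fun_ideal_adjoin[OF M(1) gc, folded M'_def]
    have "(\<lambda>x. 1) \<notin> M'"
    proof
      assume "(\<lambda>x. 1) \<in> M'"
      then obtain i h where ih: "i \<in> M" "h \<in> fun_alg E" "(\<lambda>x. 1) = (\<lambda>x. i x + h x * (g x - c))"
        unfolding M'_def by blast
      have "(\<lambda>x. 1 - h x * (g x - c)) = i"
        by (rule ext) (use fun_cong[OF ih(3)] in \<open>simp add: algebra_simps\<close>)
      with c ih(1,2) show False by blast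
    qed
    moreover have "\<forall>e\<in>insert g F. const_mod M' e"
    proof
      fix e assume "e \<in> insert g F"
      then consider "e = g" | "e \<in> F" by blast
      then show "const_mod M' e"
      proof cases
        case 1
        then show ?thesis using M'(3) unfolding const_mod_def by (intro exI[of _ c]) simp
      next
        case 2
        then show ?thesis
          using M(4) subsetD[OF M'(2)] unfolding const_mod_def by (elim ballE exE) (rule exI, auto)
      qed
    qed
    ultimately show ?case using M(2) M'(1,2) by (intro exI[of _ M']) auto
  qed
  from this[OF E order.refl] obtain M where M: "fun_ideal (fun_alg E) M" "I \<subseteq> M" "(\<lambda>x. 1) \<notin> M"
    "\<forall>e\<in>E. const_mod M e" by blast
  have all_const: "const_mod M g" if "g \<in> fun_alg E" for g
    using that
  proof induction
    case (const c)
    show ?case unfolding const_mod_def by (rule exI[of _ c]) (simp add: fun_ideal_zero[OF M(1)])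
  next
    case (gen e)
    then show ?case using M(4) by blast
  next
    case (add f g)
    obtain c where c: "(\<lambda>x. f x - c) \<in> M" using add.IH(1) unfolding const_mod_def ..
    obtain d where d: "(\<lambda>x. g x - d) \<in> M" using add.IH(2) unfolding const_mod_def ..
    have "(\<lambda>x. f x - c + (g x - d)) \<in> M" by (rule fun_ideal_add[OF M(1) c d])
    also have "(\<lambda>x. f x - c + (g x - d)) = (\<lambda>x. f x + g x - (c + d))"
      by (rule ext) simp
    finally show ?case unfolding const_mod_def by (rule exI)
  next
    case (mult f g)
    obtain c where c: "(\<lambda>x. f x - c) \<in> M" using mult.IH(1) unfolding const_mod_def ..
    obtain d where d: "(\<lambda>x. g x - d) \<in> M" using mult.IH(2) unfolding const_mod_def ..
    have gf: "(\<lambda>x. g x * (f x - c)) \<in> M" by (rule fun_ideal_mult[OF M(1) mult.hyps(2) c])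
    have cg: "(\<lambda>x. c * (g x - d)) \<in> M" by (rule fun_ideal_mult[OF M(1) fun_alg.const d])
    have "(\<lambda>x. g x * (f x - c) + c * (g x - d)) \<in> M" by (rule fun_ideal_add[OF M(1) gf cg])
    moreover have "(\<lambda>x. g x * (f x - c) + c * (g x - d)) = (\<lambda>x. f x * g x - c * d)"
      by (rule ext) (simp add: algebra_simps)
    ultimately have "(\<lambda>x. f x * g x - c * d) \<in> M" by (simp only:)
    then show ?case unfolding const_mod_def by (rule exI)
  qed
  show thesis by (rule that[OF M(1-3)]) (rule all_const)
qed

section \<open>Regular functions on the complement of a hypersurface\<close>

lemma polynomial_functions_subset_fun_alg:
  assumes "\<And>i. i < m \<Longrightarrow> (\<lambda>x. x $ i) \<in> fun_alg E"
  shows "polynomial_functions m \<subseteq> fun_alg E"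
proof
  fix P assume "P \<in> polynomial_functions m"
  then show "P \<in> fun_alg E"
    by induction (auto intro: fun_alg.const fun_alg.add fun_alg.mult assms)
qed

definition nonvanishing_locus :: "nat \<Rightarrow> nat \<Rightarrow> (nat \<Rightarrow> complex vec \<Rightarrow> complex) \<Rightarrow> complex vec set" where
  "nonvanishing_locus m n S = {x \<in> carrier_vec m. \<forall>j<n. S j x \<noteq> 0}"

definition coords_and_inverses ::
    "nat \<Rightarrow> nat \<Rightarrow> (nat \<Rightarrow> complex vec \<Rightarrow> complex) \<Rightarrow> (complex vec \<Rightarrow> complex) set" where
  "coords_and_inverses m n S = (\<lambda>i x. x $ i) ` {..<m} \<union> (\<lambda>j x. 1 / S j x) ` {..<n}"

lemma regular_onE:
  assumes "regular_on m X f" "x \<in> X"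
  obtains P Q R where "P \<in> polynomial_functions m" "Q \<in> polynomial_functions m"
    "R \<in> polynomial_functions m" "R x \<noteq> 0"
    "\<And>y. y \<in> X \<Longrightarrow> R y \<noteq> 0 \<Longrightarrow> Q y \<noteq> 0 \<and> f y = P y / Q y"
proof -
  from assms obtain P Q R where *: "P \<in> polynomial_functions m" "Q \<in> polynomial_functions m"
    "R \<in> polynomial_functions m" "R x \<noteq> 0" "\<forall>y\<in>X. R y \<noteq> 0 \<longrightarrow> Q y \<noteq> 0 \<and> f y = P y / Q y"
    unfolding regular_on_def by blast
  show thesis by (rule that[OF *(1-4)]) (use *(5) in auto)
qed

lemma regular_on_cong: "(\<And>x. x \<in> X \<Longrightarrow> f x = g x) \<Longrightarrow> regular_on m X f \<longleftrightarrow> regular_on m X g"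
  unfolding regular_on_def by (intro ball_cong bex_cong refl conj_cong) auto

lemma regular_on_polynomial: "P \<in> polynomial_functions m \<Longrightarrow> regular_on m X P"
  unfolding regular_on_def
  by (intro ballI bexI[of _ P] bexI[of _ "\<lambda>_. 1"]) (auto intro: polynomial_functions.const)

lemma regular_on_inverse:
  assumes "P \<in> polynomial_functions m" "\<And>x. x \<in> X \<Longrightarrow> P x \<noteq> 0"
  shows "regular_on m X (\<lambda>x. 1 / P x)"
  unfolding regular_on_def
  by (intro ballI bexI[of _ P] bexI[of _ "\<lambda>_. 1"])
    (use assms in \<open>auto intro: polynomial_functions.const\<close>)

lemma
  assumes "regular_on m X f" "regular_on m X g"
  shows regular_on_add: "regular_on m X (\<lambda>x. f x + g x)"
    and regular_on_mult: "regular_on m X (\<lambda>x. f x * g x)"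
proof -
  have "(\<exists>P\<in>polynomial_functions m. \<exists>Q\<in>polynomial_functions m. \<exists>R\<in>polynomial_functions m.
      R x \<noteq> 0 \<and> (\<forall>y\<in>X. R y \<noteq> 0 \<longrightarrow> Q y \<noteq> 0 \<and> f y + g y = P y / Q y))
    \<and> (\<exists>P\<in>polynomial_functions m. \<exists>Q\<in>polynomial_functions m. \<exists>R\<in>polynomial_functions m.
      R x \<noteq> 0 \<and> (\<forall>y\<in>X. R y \<noteq> 0 \<longrightarrow> Q y \<noteq> 0 \<and> f y * g y = P y / Q y))"
    if x: "x \<in> X" for x
  proof -
    obtain P Q R where f: "P \<in> polynomial_functions m" "Q \<in> polynomial_functions m"
      "R \<in> polynomial_functions m" "R x \<noteq> 0"
      "\<And>y. y \<in> X \<Longrightarrow> R y \<noteq> 0 \<Longrightarrow> Q y \<noteq> 0 \<and> f y = P y / Q y"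
      using assms(1) x by (rule regular_onE) (rule that)
    obtain P' Q' R' where g: "P' \<in> polynomial_functions m" "Q' \<in> polynomial_functions m"
      "R' \<in> polynomial_functions m" "R' x \<noteq> 0"
      "\<And>y. y \<in> X \<Longrightarrow> R' y \<noteq> 0 \<Longrightarrow> Q' y \<noteq> 0 \<and> g y = P' y / Q' y"
      using assms(2) x by (rule regular_onE) (rule that)
    have R: "(\<lambda>y. R y * R' y) \<in> polynomial_functions m" and Q: "(\<lambda>y. Q y * Q' y) \<in> polynomial_functions m"
      and P: "(\<lambda>y. P y * P' y) \<in> polynomial_functions m"
      and S: "(\<lambda>y. P y * Q' y + P' y * Q y) \<in> polynomial_functions m"
      by (intro polynomial_functions.mult polynomial_functions.add f g)+
    show ?thesis
      by (intro conjI bexI[OF bexI[OF bexI[OF _ R] Q] S] bexI[OF bexI[OF bexI[OF _ R] Q] P])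
        (use f g in \<open>auto simp: add_frac_eq\<close>)
  qed
  then show "regular_on m X (\<lambda>x. f x + g x)" "regular_on m X (\<lambda>x. f x * g x)"
    unfolding regular_on_def by blast+
qed

lemma regular_on_fun_alg:
  assumes S: "\<And>j. j < n \<Longrightarrow> S j \<in> polynomial_functions m"
    and f: "f \<in> fun_alg (coords_and_inverses m n S)"
  shows "regular_on m (nonvanishing_locus m n S) f"
  using f
proof induction
  case (gen e)
  then consider i where "i < m" "e = (\<lambda>x. x $ i)" | j where "j < n" "e = (\<lambda>x. 1 / S j x)"
    unfolding coords_and_inverses_def by blast
  then show ?case
  proof cases
    case 1
    then show ?thesis by (auto intro: regular_on_polynomial polynomial_functions.coord)
  next
    case 2
    then show ?thesis by (auto intro: regular_on_inverse S simp: nonvanishing_locus_def)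
  qed
qed (auto intro: regular_on_add regular_on_mult regular_on_polynomial polynomial_functions.const)

text \<open>
  A regular function is only locally a fraction; here it is shown to be one global expression.
  The functions \<open>q\<close> such that \<open>q f\<close> agrees with an element of the algebra form an ideal of
  denominators. If it were proper, it would lie in the kernel of a character, which is evaluation
  at some point \<open>y\<close>. As the inverses of the \<open>S j\<close> belong to the algebra, no \<open>S j\<close> vanishes at
  \<open>y\<close>, so \<open>f\<close> has a local representation \<open>P / Q\<close> valid where \<open>R\<close> does not vanish. But then
  \<open>Q R\<close> is a denominator that does not vanish at \<open>y\<close>.
\<close>

theorem regular_on_nonvanishing_locus:
  assumes S: "\<And>j. j < n \<Longrightarrow> S j \<in> polynomial_functions m"
    and f: "regular_on m (nonvanishing_locus m n S) f"
  obtains g where "g \<in> fun_alg (coords_and_inverses m n S)"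
    "\<And>x. x \<in> nonvanishing_locus m n S \<Longrightarrow> f x = g x"
proof -
  define E where "E = coords_and_inverses m n S"
  define X where "X = nonvanishing_locus m n S"
  define I where "I = {q \<in> fun_alg E. \<exists>p\<in>fun_alg E. \<forall>x\<in>X. q x * f x = p x}"
  have poly: "P \<in> fun_alg E" if "P \<in> polynomial_functions m" for P
    using polynomial_functions_subset_fun_alg[of m E] that
    by (auto simp: E_def coords_and_inverses_def intro: fun_alg.gen)
  have I: "fun_ideal (fun_alg E) I"
    unfolding fun_ideal_def
  proof (intro conjI ballI)
    show "I \<subseteq> fun_alg E" by (auto simp: I_def)
    show "(\<lambda>x. 0) \<in> I" unfolding I_def
      by (intro CollectI conjI fun_alg.const bexI[OF _ fun_alg.const[of 0]]) simp
  next
    fix q q' assume "q \<in> I" "q' \<in> I"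
    then obtain p p' where *: "q \<in> fun_alg E" "q' \<in> fun_alg E" "p \<in> fun_alg E" "p' \<in> fun_alg E"
      "\<forall>x\<in>X. q x * f x = p x" "\<forall>x\<in>X. q' x * f x = p' x"
      unfolding I_def by (elim CollectE conjE bexE) 
    show "(\<lambda>x. q x + q' x) \<in> I" unfolding I_def
      by (intro CollectI conjI fun_alg.add *(1,2) bexI[OF _ fun_alg.add[OF *(3,4)]])
        (use *(5,6) in \<open>simp add: distrib_right\<close>)
  next
    fix r q assume r: "r \<in> fun_alg E" and "q \<in> I"
    then obtain p where *: "q \<in> fun_alg E" "p \<in> fun_alg E" "\<forall>x\<in>X. q x * f x = p x"
      unfolding I_def by (elim CollectE conjE bexE)
    show "(\<lambda>x. r x * q x) \<in> I" unfolding I_def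
      by (intro CollectI conjI fun_alg.mult r *(1) bexI[OF _ fun_alg.mult[OF r *(2)]])
        (use *(3) in \<open>simp add: mult.assoc\<close>)
  qed
  have vanish: "q \<in> I" if "q \<in> fun_alg E" "\<And>x. x \<in> X \<Longrightarrow> q x = 0" for q
    unfolding I_def by (intro CollectI conjI that(1) bexI[OF _ fun_alg.const[of 0]]) (simp add: that(2))
  have "(\<lambda>x. 1) \<in> I"
  proof (rule ccontr)
    assume "(\<lambda>x. 1) \<notin> I"
    moreover have "finite E" by (simp add: E_def coords_and_inverses_def)
    ultimately obtain M where M: "fun_ideal (fun_alg E) M" "I \<subseteq> M" "(\<lambda>x. 1) \<notin> M"
      and residue: "\<And>g. g \<in> fun_alg E \<Longrightarrow> const_mod M g"
      using proper_ideal_in_codim_one_ideal[OF _ I] by blast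
    have const_notin: "c = 0" if "(\<lambda>x. c) \<in> M" for c
    proof (rule ccontr)
      assume "c \<noteq> 0"
      then show False using fun_ideal_mult[OF M(1) fun_alg.const[of "1 / c"] that] M(3) by simp
    qed
    \<comment> \<open>The residues of the coordinates modulo \<open>M\<close> form a point, and evaluation at this point is
      reduction modulo \<open>M\<close>.\<close>
    have "\<forall>i<m. \<exists>c. (\<lambda>x. x $ i - c) \<in> M"
    proof (intro allI impI)
      fix i assume "i < m"
      then have "(\<lambda>x. x $ i) \<in> fun_alg E"
        by (auto simp: E_def coords_and_inverses_def intro: fun_alg.gen)
      from residue[OF this] show "\<exists>c. (\<lambda>x. x $ i - c) \<in> M" unfolding const_mod_def .
    qed
    then obtain c where c: "\<And>i. i < m \<Longrightarrow> (\<lambda>x. x $ i - c i) \<in> M"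
      unfolding choice_iff' by (elim exE) (rule that, blast)
    define y where "y = vec m c"
    have eval: "(\<lambda>x. P x - P y) \<in> M" if "P \<in> polynomial_functions m" for P
      using that
    proof induction
      case (const d)
      show ?case using fun_ideal_zero[OF M(1)] by simp
    next
      case (coord i)
      then show ?case using c by (simp add: y_def)
    next
      case (add P Q)
      have "(\<lambda>x. (P x - P y) + (Q x - Q y)) \<in> M" by (rule fun_ideal_add[OF M(1) add.IH])
      moreover have "(\<lambda>x. (P x - P y) + (Q x - Q y)) = (\<lambda>x. P x + Q x - (P y + Q y))"
        by (rule ext) simp
      ultimately show ?case by (simp only:)
    next
      case (mult P Q)
      have 1: "(\<lambda>x. Q x * (P x - P y)) \<in> M"
        by (rule fun_ideal_mult[OF M(1) poly[OF mult.hyps(2)] mult.IH(1)])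
      have 2: "(\<lambda>x. P y * (Q x - Q y)) \<in> M"
        by (rule fun_ideal_mult[OF M(1) fun_alg.const mult.IH(2)])
      have "(\<lambda>x. Q x * (P x - P y) + P y * (Q x - Q y)) \<in> M"
        by (rule fun_ideal_add[OF M(1) 1 2])
      moreover have "(\<lambda>x. Q x * (P x - P y) + P y * (Q x - Q y)) = (\<lambda>x. P x * Q x - P y * Q y)"
        by (rule ext) (simp add: algebra_simps)
      ultimately show ?case by (simp only:)
    qed
    have "y \<in> X"
      unfolding X_def nonvanishing_locus_def
    proof (intro CollectI conjI allI impI notI)
      show "y \<in> carrier_vec m" by (simp add: y_def)
      fix j assume j: "j < n" "S j y = 0"
      have inv: "(\<lambda>x. 1 / S j x) \<in> fun_alg E"
        using j by (auto simp: E_def coords_and_inverses_def intro: fun_alg.gen)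
      have 1: "(\<lambda>x. 1 / S j x * S j x) \<in> M"
        using fun_ideal_mult[OF M(1) inv eval[OF S[OF j(1)]]] j(2) by simp
      have 2: "(\<lambda>x. 1 - 1 / S j x * S j x) \<in> M"
        by (intro subsetD[OF M(2)] vanish fun_alg_diff fun_alg.const fun_alg.mult inv poly S j(1))
          (use j(1) in \<open>simp add: X_def nonvanishing_locus_def\<close>)
      have "(\<lambda>x. 1 / S j x * S j x + (1 - 1 / S j x * S j x)) \<in> M"
        by (rule fun_ideal_add[OF M(1) 1 2])
      then show False using M(3) by simp
    qed
    from f[folded X_def] this obtain P Q R where PQR: "P \<in> polynomial_functions m" "Q \<in> polynomial_functions m"
      "R \<in> polynomial_functions m" "R y \<noteq> 0"
      "\<And>x. x \<in> X \<Longrightarrow> R x \<noteq> 0 \<Longrightarrow> Q x \<noteq> 0 \<and> f x = P x / Q x"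
      by (rule regular_onE) (rule that)
    have QR: "(\<lambda>x. Q x * R x) \<in> polynomial_functions m"
      by (intro polynomial_functions.mult PQR)
    \<comment> \<open>Where \<open>R\<close> vanishes both sides are zero.\<close>
    have "\<forall>x\<in>X. Q x * R x * f x = P x * R x"
    proof
      fix x assume "x \<in> X"
      then show "Q x * R x * f x = P x * R x" using PQR(5)[of x] by (cases "R x = 0") auto
    qed
    then have "(\<lambda>x. Q x * R x) \<in> I" unfolding I_def
      by (intro CollectI conjI poly[OF QR] bexI[OF _ fun_alg.mult[OF poly[OF PQR(1)] poly[OF PQR(3)]]])
    then have "(\<lambda>x. Q x * R x - (Q x * R x - Q y * R y)) \<in> M"
      by (intro fun_ideal_diff[OF M(1)] subsetD[OF M(2)] eval[OF QR])
    then have "Q y * R y = 0" by (intro const_notin) simp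
    with PQR(4,5) \<open>y \<in> X\<close> show False by auto
  qed
  then obtain g where "g \<in> fun_alg E" "\<forall>x\<in>X. 1 * f x = g x"
    unfolding I_def by (elim CollectE conjE bexE)
  then show thesis using that by (simp add: E_def X_def)
qed

section \<open>Rings of regular functions\<close>

lemma restrict_in_regular_ring [simp]:
  "restrict f X \<in> carrier (regular_ring m X) \<longleftrightarrow> regular_on m X f"
  by (simp add: regular_ring_def cong: regular_on_cong)

lemma
  shows regular_ring_add [simp]: "restrict f X \<oplus>\<^bsub>regular_ring m X\<^esub> restrict g X = restrict (\<lambda>x. f x + g x) X"
    and regular_ring_mult [simp]: "restrict f X \<otimes>\<^bsub>regular_ring m X\<^esub> restrict g X = restrict (\<lambda>x. f x * g x) X"
    and regular_ring_zero: "\<zero>\<^bsub>regular_ring m X\<^esub> = restrict (\<lambda>x. 0) X"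
    and regular_ring_one: "\<one>\<^bsub>regular_ring m X\<^esub> = restrict (\<lambda>x. 1) X"
  by (auto simp: regular_ring_def restrict_def)

lemma regular_ringE:
  assumes "u \<in> carrier (regular_ring m X)"
  obtains f where "u = restrict f X" "regular_on m X f"
  using assms by (intro that[of u]) (auto simp: regular_ring_def extensional_restrict)

lemma regular_on_const: "regular_on m X (\<lambda>x. c)"
  by (intro regular_on_polynomial polynomial_functions.const)

lemma regular_on_cmult: "regular_on m X f \<Longrightarrow> regular_on m X (\<lambda>x. c * f x)"
  by (intro regular_on_mult regular_on_const)

lemma regular_on_diff:
  assumes "regular_on m X f" "regular_on m X g"
  shows "regular_on m X (\<lambda>x. f x - g x)"
  using regular_on_add[OF assms(1) regular_on_cmult[OF assms(2), of "-1"]] by simp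

lemma regular_ring_cring: "cring (regular_ring m X)"
proof (rule cringI)
  let ?R = "regular_ring m X"
  show "abelian_group ?R"
  proof (rule abelian_groupI)
    fix u assume "u \<in> carrier ?R"
    then obtain f where f: "u = restrict f X" "regular_on m X f" by (rule regular_ringE)
    show "\<exists>v\<in>carrier ?R. v \<oplus>\<^bsub>?R\<^esub> u = \<zero>\<^bsub>?R\<^esub>"
      by (rule bexI[of _ "restrict (\<lambda>x. - 1 * f x) X"])
        (use regular_on_cmult[OF f(2), of "-1"] in \<open>auto simp: f regular_ring_zero\<close>)
  qed (auto elim!: regular_ringE simp: regular_ring_zero regular_on_add regular_on_const algebra_simps)
  show "comm_monoid ?R"
    by (rule comm_monoidI)
      (auto elim!: regular_ringE simp: regular_ring_one regular_on_mult regular_on_const algebra_simps)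
qed (auto elim!: regular_ringE simp: algebra_simps)

lemma
  assumes "ideal K (regular_ring m X)"
  shows ideal_restrict_zero: "(\<And>x. x \<in> X \<Longrightarrow> f x = 0) \<Longrightarrow> restrict f X \<in> K"
    and ideal_restrict_add: "restrict f X \<in> K \<Longrightarrow> restrict g X \<in> K \<Longrightarrow> restrict (\<lambda>x. f x + g x) X \<in> K"
    and ideal_restrict_mult: "regular_on m X r \<Longrightarrow> restrict f X \<in> K \<Longrightarrow> restrict (\<lambda>x. r x * f x) X \<in> K"
proof -
  interpret ideal K "regular_ring m X" by fact
  show "restrict f X \<in> K" if "\<And>x. x \<in> X \<Longrightarrow> f x = 0"
  proof -
    have "restrict f X = restrict (\<lambda>x. 0) X" using that by (intro restrict_ext)
    then show ?thesis using additive_subgroup.zero_closed[OF is_additive_subgroup] by (simp add: regular_ring_zero)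
  qed
  show "restrict (\<lambda>x. f x + g x) X \<in> K" if "restrict f X \<in> K" "restrict g X \<in> K"
    using additive_subgroup.a_closed[OF is_additive_subgroup that] by simp
  show "restrict (\<lambda>x. r x * f x) X \<in> K" if "regular_on m X r" "restrict f X \<in> K"
    using I_l_closed[OF that(2), of "restrict r X"] that(1) by simp
qed

lemma ideal_restrict_sum:
  assumes "ideal K (regular_ring m X)"
  shows "(\<And>i. i \<in> A \<Longrightarrow> restrict (f i) X \<in> K) \<Longrightarrow> restrict (\<lambda>x. \<Sum>i\<in>A. f i x) X \<in> K"
  by (induction A rule: infinite_finite_induct)
    (auto intro: ideal_restrict_zero[OF assms] ideal_restrict_add[OF assms])

lemma ideal_restrict_cong:
  "restrict f X \<in> K \<Longrightarrow> (\<And>x. x \<in> X \<Longrightarrow> f x = g x) \<Longrightarrow> restrict g X \<in> K"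
  using restrict_ext[of X f g] by simp

lemma pullback_ring_hom:
  assumes "\<And>x. x \<in> X \<Longrightarrow> \<alpha> x \<in> Y"
    and "\<And>u. regular_on n Y u \<Longrightarrow> regular_on m X (\<lambda>x. u (\<alpha> x))"
  shows "(\<lambda>u. restrict (\<lambda>x. u (\<alpha> x)) X) \<in> ring_hom (regular_ring n Y) (regular_ring m X)"
proof (rule ring_hom_memI)
  fix u assume "u \<in> carrier (regular_ring n Y)"
  then have "regular_on n Y u" by (simp add: regular_ring_def)
  then show "restrict (\<lambda>x. u (\<alpha> x)) X \<in> carrier (regular_ring m X)" using assms(2) by simp
qed (use assms(1) in \<open>auto simp: regular_ring_def intro!: restrict_ext\<close>)

text \<open>
  By the preceding section the ring is generated by constants, coordinates and inverses of
  polynomials, and a ring homomorphism is determined on an inverse by its value on the element.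
\<close>

lemma ring_hom_eq_on_regular_ring:
  assumes S: "\<And>j. j < n \<Longrightarrow> S j \<in> polynomial_functions m"
  defines "X \<equiv> nonvanishing_locus m n S"
  assumes C: "cring C"
    and h: "h \<in> ring_hom (regular_ring m X) C" and h': "h' \<in> ring_hom (regular_ring m X) C"
    and agree_const: "\<And>c. h (restrict (\<lambda>x. c) X) = h' (restrict (\<lambda>x. c) X)"
    and agree_coord: "\<And>i. i < m \<Longrightarrow> h (restrict (\<lambda>x. x $ i) X) = h' (restrict (\<lambda>x. x $ i) X)"
    and u: "u \<in> carrier (regular_ring m X)"
  shows "h u = h' u"
proof -
  interpret C: cring C by fact
  have sum: "k (restrict (\<lambda>x. f x + g x) X) = k (restrict f X) \<oplus>\<^bsub>C\<^esub> k (restrict g X)"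
    and prod: "k (restrict (\<lambda>x. f x * g x) X) = k (restrict f X) \<otimes>\<^bsub>C\<^esub> k (restrict g X)"
    if "k \<in> ring_hom (regular_ring m X) C" "regular_on m X f" "regular_on m X g" for k f g
    using ring_hom_add[OF that(1), of "restrict f X" "restrict g X"]
      ring_hom_mult[OF that(1), of "restrict f X" "restrict g X"] that(2,3) by auto
  have closed: "k (restrict f X) \<in> carrier C"
    if "k \<in> ring_hom (regular_ring m X) C" "regular_on m X f" for k f
    using ring_hom_closed[OF that(1), of "restrict f X"] that(2) by simp
  have poly: "h (restrict P X) = h' (restrict P X)" if "P \<in> polynomial_functions m" for P
    using that
  proof induction
    case (const c)
    show ?case by (rule agree_const)
  next
    case (coord i)
    then show ?case by (rule agree_coord)
  next
    case (add P Q)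
    note reg = add.hyps[THEN regular_on_polynomial]
    show ?case unfolding sum[OF h reg] sum[OF h' reg] add.IH ..
  next
    case (mult P Q)
    note reg = mult.hyps[THEN regular_on_polynomial]
    show ?case unfolding prod[OF h reg] prod[OF h' reg] mult.IH ..
  qed
  have inverse: "h (restrict (\<lambda>x. 1 / S j x) X) = h' (restrict (\<lambda>x. 1 / S j x) X)" if j: "j < n" for j
  proof -
    have nz: "S j x \<noteq> 0" if "x \<in> X" for x using that j by (simp add: X_def nonvanishing_locus_def)
    note reg = regular_on_inverse[OF S[OF j] nz] regular_on_polynomial[OF S[OF j]]
    have "restrict (\<lambda>x. 1 / S j x * S j x) X = restrict (\<lambda>x. 1) X"
      by (rule restrict_ext) (simp add: nz)
    then have "k (restrict (\<lambda>x. 1 / S j x) X) \<otimes>\<^bsub>C\<^esub> k (restrict (S j) X) = \<one>\<^bsub>C\<^esub>"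
      if "k \<in> ring_hom (regular_ring m X) C" for k
      using prod[OF that reg] ring_hom_one[OF that] by (simp add: regular_ring_one)
    from this[OF h] this[OF h'] show ?thesis
      using poly[OF S[OF j]] closed[OF h reg(1)] closed[OF h' reg(1)] closed[OF h' reg(2)]
      by (metis C.inv_unique C.m_comm)
  qed
  from u obtain f where f: "u = restrict f X" "regular_on m X f" by (rule regular_ringE)
  obtain g where g: "g \<in> fun_alg (coords_and_inverses m n S)" "\<And>x. x \<in> X \<Longrightarrow> f x = g x"
    using regular_on_nonvanishing_locus[OF S f(2)[unfolded X_def]] unfolding X_def by blast
  have reg: "regular_on m X g" if "g \<in> fun_alg (coords_and_inverses m n S)" for g
    unfolding X_def by (rule regular_on_fun_alg[OF S that])
  have "h (restrict g X) = h' (restrict g X)"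
    using g(1)
  proof induction
    case (gen e)
    then consider i where "i < m" "e = (\<lambda>x. x $ i)" | j where "j < n" "e = (\<lambda>x. 1 / S j x)"
      unfolding coords_and_inverses_def by blast
    then show ?case
    proof cases
      case 1
      then show ?thesis using agree_coord by (simp only:)
    next
      case 2
      then show ?thesis using inverse by (simp only:)
    qed
  next
    case (const c)
    show ?case by (rule agree_const)
  next
    case (add f g)
    note reg = add.hyps[THEN reg]
    show ?case unfolding sum[OF h reg] sum[OF h' reg] add.IH ..
  next
    case (mult f g)
    note reg = mult.hyps[THEN reg]
    show ?case unfolding prod[OF h reg] prod[OF h' reg] mult.IH ..
  qed
  moreover have "u = restrict g X" unfolding f(1) by (rule restrict_ext) (rule g(2))
  ultimately show ?thesis by simp
qed

lemma ideal_image_surj: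
  assumes h: "ring_hom_ring R S h" and surj: "h ` carrier R = carrier S" and I: "ideal I R"
  shows "ideal (h ` I) S"
proof -
  interpret h: ring_hom_ring R S h by fact
  interpret I: ideal I R by fact
  show ?thesis
  proof (rule idealI)
    show "ring S" by (rule h.S.ring_axioms)
    show "subgroup (h ` I) (add_monoid S)"
      by (rule h.img_is_add_subgroup[OF additive_subgroup.a_subgroup[OF I.is_additive_subgroup]])
  next
    fix y x assume "y \<in> h ` I" "x \<in> carrier S"
    then obtain i r where "i \<in> I" "y = h i" "r \<in> carrier R" "x = h r" using surj by blast
    then have "x \<otimes>\<^bsub>S\<^esub> y = h (r \<otimes>\<^bsub>R\<^esub> i)" "y \<otimes>\<^bsub>S\<^esub> x = h (i \<otimes>\<^bsub>R\<^esub> r)" by (simp_all add: I.a_Hcarr)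
    then show "x \<otimes>\<^bsub>S\<^esub> y \<in> h ` I" "y \<otimes>\<^bsub>S\<^esub> x \<in> h ` I"
      using I.I_l_closed[OF \<open>i \<in> I\<close> \<open>r \<in> carrier R\<close>] I.I_r_closed[OF \<open>i \<in> I\<close> \<open>r \<in> carrier R\<close>]
      by (simp_all only: imageI)
  qed
qed

text \<open>
  The composition of \<open>h\<close> with the projection to \<open>S Quot J\<close> is surjective, and its kernel is exactly
  \<open>I\<close>: if \<open>h x\<close> lies in \<open>J = h ` I\<close>, then \<open>x\<close> differs from an element of \<open>I\<close> by an element of the
  kernel of \<open>h\<close>.
\<close>

lemma quotient_ring_iso:
  assumes h: "ring_hom_ring R S h" and surj: "h ` carrier R = carrier S"
    and I: "ideal I R" and J: "ideal J S" and image: "h ` I = J" and ker: "a_kernel R S h \<subseteq> I"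
  shows "\<exists>\<phi>\<in>ring_iso (R Quot I) (S Quot J). \<forall>x\<in>carrier R. \<phi> (I +>\<^bsub>R\<^esub> x) = J +>\<^bsub>S\<^esub> h x"
proof -
  interpret h: ring_hom_ring R S h by fact
  interpret I: ideal I R by fact
  interpret J: ideal J S by fact
  define q where "q x = J +>\<^bsub>S\<^esub> h x" for x
  have q_hom: "q \<in> ring_hom R (S Quot J)"
    using ring_hom_trans[OF h.homh J.rcos_ring_hom] by (simp add: q_def[abs_def] comp_def)
  interpret q: ring_hom_ring R "S Quot J" q
    by (rule ring_hom_ringI2[OF h.R.ring_axioms J.quotient_is_ring q_hom])
  have q_zero: "q x = \<zero>\<^bsub>S Quot J\<^esub> \<longleftrightarrow> h x \<in> J" if "x \<in> carrier R" for x
  proof -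
    have "J +>\<^bsub>S\<^esub> h x = J \<longleftrightarrow> h x \<in> J"
    proof
      assume "J +>\<^bsub>S\<^esub> h x = J"
      then show "h x \<in> J" using J.a_rcos_self[OF h.hom_closed[OF that]] by (simp only:)
    qed (rule J.a_rcos_const)
    then show ?thesis by (simp add: q_def FactRing_def)
  qed
  have "a_kernel R (S Quot J) q = {x \<in> carrier R. h x \<in> J}"
    unfolding a_kernel_def' using q_zero by (intro Collect_cong conj_cong refl)
  also have "\<dots> = I"
  proof (intro equalityI subsetI)
    fix x assume "x \<in> I"
    then show "x \<in> {x \<in> carrier R. h x \<in> J}"
      unfolding image[symmetric] by (intro CollectI conjI imageI I.a_Hcarr)
  next
    fix x assume "x \<in> {x \<in> carrier R. h x \<in> J}"
    then have x: "x \<in> carrier R" "h x \<in> h ` I" unfolding image by blast+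
    then obtain y where y: "y \<in> I" "h x = h y" by blast
    then have y_carrier: "y \<in> carrier R" by (intro I.a_Hcarr)
    have "h (x \<ominus>\<^bsub>R\<^esub> y) = h y \<ominus>\<^bsub>S\<^esub> h y"
      unfolding a_minus_def using x(1) y_carrier by (simp add: y(2))
    also have "\<dots> = \<zero>\<^bsub>S\<^esub>" using y_carrier by (simp add: a_minus_def h.S.r_neg)
    finally have "x \<ominus>\<^bsub>R\<^esub> y \<in> a_kernel R S h"
      unfolding a_kernel_def' using x(1) y_carrier by (intro CollectI conjI h.R.minus_closed)
    then have "(x \<ominus>\<^bsub>R\<^esub> y) \<oplus>\<^bsub>R\<^esub> y \<in> I"
      by (intro additive_subgroup.a_closed[OF I.is_additive_subgroup] subsetD[OF ker] y(1))
    also have "(x \<ominus>\<^bsub>R\<^esub> y) \<oplus>\<^bsub>R\<^esub> y = x" using x(1) y_carrier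
      by (simp add: a_minus_def h.R.a_assoc h.R.l_neg)
    finally show "x \<in> I" .
  qed
  finally have "a_kernel R (S Quot J) q = I" .
  moreover have "q ` carrier R = carrier (S Quot J)"
  proof -
    have "carrier (S Quot J) = (\<lambda>y. J +>\<^bsub>S\<^esub> y) ` carrier S"
      by (auto simp: FactRing_def A_RCOSETS_def')
    then show ?thesis unfolding surj[symmetric] image_image q_def by (rule sym)
  qed
  ultimately have iso: "(\<lambda>A. the_elem (q ` A)) \<in> ring_iso (R Quot I) (S Quot J)"
    using q.FactRing_iso_set by (simp only:)
  have elem: "the_elem (q ` (I +>\<^bsub>R\<^esub> x)) = J +>\<^bsub>S\<^esub> h x" if x: "x \<in> carrier R" for x
  proof -
    have q_const: "q y = q x" if "y \<in> I +>\<^bsub>R\<^esub> x" for y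
    proof -
      from that obtain i where i: "i \<in> I" "y = i \<oplus>\<^bsub>R\<^esub> x" by (auto simp: a_r_coset_def')
      then have "i \<in> carrier R" by (simp add: I.a_Hcarr)
      then have "q y = q i \<oplus>\<^bsub>S Quot J\<^esub> q x" using i x by simp
      moreover have "h i \<in> J" unfolding image[symmetric] using i(1) by (rule imageI)
      ultimately show ?thesis using q_zero[OF \<open>i \<in> carrier R\<close>] x by simp
    qed
    have "x \<in> I +>\<^bsub>R\<^esub> x" using x by (rule I.a_rcos_self)
    then have "(\<lambda>_. q x) ` (I +>\<^bsub>R\<^esub> x) = {q x}" by (rule image_constant)
    moreover have "q ` (I +>\<^bsub>R\<^esub> x) = (\<lambda>_. q x) ` (I +>\<^bsub>R\<^esub> x)"
      by (rule image_cong[OF refl q_const])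
    ultimately have "q ` (I +>\<^bsub>R\<^esub> x) = {q x}" by (simp only:)
    then show ?thesis by (simp add: q_def)
  qed
  show ?thesis by (rule bexI[OF _ iso]) (intro ballI elem)
qed

section \<open>Linear algebra of the arrangement\<close>

lemma nth_omit: "m < length is \<Longrightarrow> l < length is - 1 \<Longrightarrow> omit m is ! l = is ! (if l < m then l else Suc l)"
  by (auto simp: omit_def nth_append min_def)

text \<open>
  The left-hand side is the Laplace expansion, along its first column, of the determinant whose
  columns are column \<open>r\<close> followed by all columns \<open>0, ..., k - 1\<close> of the rows \<open>b (is ! m)\<close>. Two of
  its columns are equal.
\<close>

lemma circuit_relation:
  assumes "length is = k + 1" "r < k"
  shows "(\<Sum>m<k+1. (-1) ^ m * d_minor k b (omit m is) * b (is ! m) r) = 0"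
proof -
  define A where "A = mat (k+1) (k+1) (\<lambda>(l, c). b (is ! l) (if c = 0 then r else c - 1))"
  have A: "A \<in> carrier_mat (k+1) (k+1)" by (simp add: A_def)
  have "mat_delete A m 0 = mat k k (\<lambda>(l, c). b (omit m is ! l) c)" if "m < k + 1" for m
    using that assms(1) by (intro eq_matI) (auto simp: mat_delete_def A_def nth_omit)
  then have "(\<Sum>m<k+1. (-1) ^ m * d_minor k b (omit m is) * b (is ! m) r)
      = (\<Sum>m<k+1. A $$ (m, 0) * cofactor A m 0)"
    by (intro sum.cong) (auto simp: cofactor_def d_minor_def A_def)
  also have "\<dots> = det A" by (rule laplace_expansion_column[OF A, symmetric]) simp
  also have "\<dots> = 0"
    using assms(2) by (intro det_identical_columns[OF A, of 0 "Suc r"]) (auto simp: A_def)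
  finally show ?thesis .
qed

text \<open>
  The linear parts cancel by the circuit relation. Hence the values of the \<open>f_lin\<close>, at every
  point \<open>t\<close>, satisfy the same inhomogeneous linear relation.
\<close>

lemma circuit_sum_f_lin:
  assumes "length is = k + 1"
  shows "(\<Sum>m<k+1. (-1) ^ m * d_minor k b (omit m is) * f_lin k b (is ! m) z t) = f_circuit k b is z"
proof -
  let ?c = "\<lambda>m. (-1) ^ m * d_minor k b (omit m is)"
  have "(\<Sum>m<k+1. ?c m * g_lin k b (is ! m) t) = (\<Sum>m<k+1. \<Sum>r<k. ?c m * b (is ! m) r * t $ r)"
    by (simp add: g_lin_def sum_distrib_left mult.assoc)
  also have "\<dots> = (\<Sum>r<k. (\<Sum>m<k+1. ?c m * b (is ! m) r) * t $ r)"
    by (subst sum.swap) (simp only: sum_distrib_right)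
  also have "\<dots> = 0"
    using circuit_relation[OF assms] by (intro sum.neutral) auto
  finally have "(\<Sum>m<k+1. ?c m * g_lin k b (is ! m) t) = 0" .
  then show ?thesis
    unfolding f_lin_def f_circuit_def distrib_left sum.distrib by simp
qed

text \<open>
  Up to a unit, \<open>F_large\<close> measures by how much the quantities \<open>a j / p $ j\<close> fail to satisfy the linear
  relation of \<open>circuit_sum_f_lin\<close>. The point \<open>t\<close> is arbitrary, and later chosen to make most
  summands vanish.
\<close>

lemma F_large_eq:
  assumes "length is = k + 1" "\<And>m. m < k + 1 \<Longrightarrow> p $ (is ! m) \<noteq> 0"
  shows "F_large k a b is z p = (\<Prod>m<k+1. p $ (is ! m))
    * (\<Sum>m<k+1. (-1) ^ m * d_minor k b (omit m is) * (f_lin k b (is ! m) z t - a (is ! m) / p $ (is ! m)))"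
proof -
  let ?c = "\<lambda>m. (-1) ^ m * d_minor k b (omit m is)"
  let ?P = "\<Prod>m<k+1. p $ (is ! m)"
  have "(\<Sum>m<k+1. (-1) ^ (m + 1) * a (is ! m) * d_minor k b (omit m is)
        * (\<Prod>l\<in>{..<k+1} - {m}. p $ (is ! l)))
    = (\<Sum>m<k+1. - (?P * (?c m * (a (is ! m) / p $ (is ! m)))))"
  proof (rule sum.cong[OF refl])
    fix m assume m: "m \<in> {..<k+1}"
    then have "?P = p $ (is ! m) * (\<Prod>l\<in>{..<k+1} - {m}. p $ (is ! l))"
      by (intro prod.remove) auto
    then show "(-1) ^ (m + 1) * a (is ! m) * d_minor k b (omit m is)
        * (\<Prod>l\<in>{..<k+1} - {m}. p $ (is ! l)) = - (?P * (?c m * (a (is ! m) / p $ (is ! m))))"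
      using assms(2)[of m] m by (simp only: lessThan_iff) (simp add: field_simps)
  qed
  also have "\<dots> = - ?P * (\<Sum>m<k+1. ?c m * (a (is ! m) / p $ (is ! m)))"
    by (simp only: sum_negf sum_distrib_left[symmetric] mult_minus_left)
  finally show ?thesis
    unfolding F_large_def circuit_sum_f_lin[OF assms(1), symmetric, of b z t]
      right_diff_distrib sum_subtractf by (simp only: right_diff_distrib mult_minus_left) simp
qed

text \<open>
  The partial derivative of the master function, written in the variables \<open>p $ j = a j / f_lin k b j z t\<close>.
\<close>

definition dPhi_lin :: "nat \<Rightarrow> (nat \<Rightarrow> nat \<Rightarrow> complex) \<Rightarrow> nat \<Rightarrow> complex vec \<Rightarrow> complex" where
  "dPhi_lin n b m p = (\<Sum>j<n. b j m * p $ j)"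

text \<open>
  Laplace expansion along the first row, whose complementary minors do not involve \<open>j\<close>.
\<close>

lemma F_small_eq:
  assumes k: "0 < k"
  shows "F_small k n b is p
    = (\<Sum>m<k. (-1) ^ m * det (mat (k-1) (k-1) (\<lambda>(l, c). b (is ! l) (if c < m then c else Suc c)))
        * dPhi_lin n b m p)"
proof -
  let ?c = "\<lambda>m. (-1) ^ m * det (mat (k-1) (k-1) (\<lambda>(l, c). b (is ! l) (if c < m then c else Suc c)))"
  have "d_minor k b (j # is) = (\<Sum>m<k. b j m * ?c m)" for j
  proof -
    define A where "A = mat k k (\<lambda>(l, c). b ((j # is) ! l) c)"
    have A: "A \<in> carrier_mat k k" by (simp add: A_def)
    have "mat_delete A 0 m = mat (k-1) (k-1) (\<lambda>(l, c). b (is ! l) (if c < m then c else Suc c))"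
      if "m < k" for m
      using that by (intro eq_matI) (auto simp: mat_delete_def A_def)
    then have "(\<Sum>m<k. A $$ (0, m) * cofactor A 0 m) = (\<Sum>m<k. b j m * ?c m)"
      using k by (intro sum.cong) (auto simp: cofactor_def A_def)
    then show ?thesis
      using laplace_expansion_row[OF A k] by (simp add: d_minor_def A_def)
  qed
  then have "F_small k n b is p = (\<Sum>j<n. \<Sum>m<k. ?c m * (b j m * p $ j))"
    by (simp add: F_small_def sum_distrib_right sum_distrib_left algebra_simps)
  also have "\<dots> = (\<Sum>m<k. ?c m * dPhi_lin n b m p)"
    by (subst sum.swap) (simp only: dPhi_lin_def sum_distrib_left)
  finally show ?thesis .
qed

locale generic_arrangement =
  fixes k n :: nat and a :: "nat \<Rightarrow> complex" and b :: "nat \<Rightarrow> nat \<Rightarrow> complex" and z :: "complex vec"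
  assumes k_pos: "0 < k" and k_less: "k < n"
    and generic: "length is = k \<Longrightarrow> distinct is \<Longrightarrow> set is \<subseteq> {..<n} \<Longrightarrow> d_minor k b is \<noteq> 0"
    and a_nonzero: "j < n \<Longrightarrow> a j \<noteq> 0"
begin

text \<open>
  By genericity the first \<open>k\<close> linear forms are coordinates on the \<open>t\<close>-space; \<open>B\<close> is the matrix of this
  change of coordinates.
\<close>

definition B :: "complex mat" where "B = mat k k (\<lambda>(l, m). b l m)"

lemma B_carrier: "B \<in> carrier_mat k k"
  by (simp add: B_def)

lemma d_minor_upt: "d_minor k b [0..<k] = det B"
  unfolding d_minor_def B_def by (intro arg_cong[of _ _ det] eq_matI) auto

lemma det_B: "det B \<noteq> 0"
  using generic[of "[0..<k]"] k_less by (auto simp: d_minor_upt subset_eq)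

text \<open>
  The inverse matrix, given by Cramer's rule.
\<close>

definition B_inv :: "nat \<Rightarrow> nat \<Rightarrow> complex" where "B_inv m l = cofactor B l m / det B"

lemma B_times_B_inv:
  assumes "j < k" "i < k"
  shows "(\<Sum>m<k. b j m * B_inv m i) = (if i = j then 1 else 0)"
proof -
  have "(\<Sum>m<k. b j m * cofactor B i m) = (B * adj_mat B) $$ (j, i)"
    using assms by (auto simp: B_def adj_mat_def scalar_prod_def lessThan_atLeast0 intro!: sum.cong)
  also have "\<dots> = (if i = j then det B else 0)"
    using assms by (simp add: adj_mat(2)[OF B_carrier])
  finally show ?thesis
    using det_B by (simp add: B_inv_def sum_divide_distrib[symmetric])
qed

lemma B_inv_times_B:
  assumes "j < k" "i < k"
  shows "(\<Sum>l<k. B_inv j l * b l i) = (if i = j then 1 else 0)"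
proof -
  have "(\<Sum>l<k. cofactor B l j * b l i) = (adj_mat B * B) $$ (j, i)"
    using assms by (auto simp: B_def adj_mat_def scalar_prod_def lessThan_atLeast0 intro!: sum.cong)
  also have "\<dots> = (if i = j then det B else 0)"
    using assms by (simp add: adj_mat(3)[OF B_carrier])
  finally show ?thesis
    using det_B by (simp add: B_inv_def sum_divide_distrib[symmetric])
qed

text \<open>
  For the index set \<open>{..<k} - {l}\<close> the minors in the expansion of \<open>F_small\<close> are those of \<open>B\<close> with row
  \<open>l\<close> deleted, that is, up to sign and the factor \<open>det B\<close>, entries of the inverse of \<open>B\<close>.
\<close>

lemma F_small_omit:
  assumes l: "l < k"
  shows "F_small k n b (omit l [0..<k]) p = (-1) ^ l * det B * (\<Sum>m<k. B_inv m l * dPhi_lin n b m p)"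
proof -
  have "mat (k-1) (k-1) (\<lambda>(i, c). b (omit l [0..<k] ! i) (if c < m then c else Suc c)) = mat_delete B l m"
    if "m < k" for m
    using that l by (intro eq_matI) (auto simp: mat_delete_def B_def nth_omit)
  then show ?thesis
    unfolding F_small_eq[OF k_pos] sum_distrib_left using det_B
    by (intro sum.cong) (auto simp: B_inv_def cofactor_def power_add)
qed

lemma dPhi_lin_eq_F_small:
  assumes i: "i < k"
  shows "dPhi_lin n b i p = (\<Sum>l<k. (b l i * (-1) ^ l / det B) * F_small k n b (omit l [0..<k]) p)"
proof -
  have "(\<Sum>l<k. (b l i * (-1) ^ l / det B) * F_small k n b (omit l [0..<k]) p)
      = (\<Sum>l<k. \<Sum>m<k. B_inv m l * b l i * dPhi_lin n b m p)"
    using det_B by (intro sum.cong refl)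
      (simp add: F_small_omit sum_distrib_left power_add[symmetric] mult_2[symmetric] algebra_simps)
  also have "\<dots> = (\<Sum>m<k. (\<Sum>l<k. B_inv m l * b l i) * dPhi_lin n b m p)"
    by (subst sum.swap) (simp only: sum_distrib_right)
  also have "\<dots> = (\<Sum>m<k. if m = i then dPhi_lin n b i p else 0)"
    using i by (intro sum.cong) (auto simp: B_inv_times_B)
  also have "\<dots> = dPhi_lin n b i p" using i by simp
  finally show ?thesis by simp
qed

text \<open>
  The map \<open>\<alpha>\<close> embeds the complement of the arrangement into the torus. Its left inverse \<open>\<beta>\<close> solves
  the first \<open>k\<close> of the equations \<open>f_lin k b j z t = a j / p $ j\<close> for \<open>t\<close>; it is defined on the whole
  torus, but its values need not lie in the complement of the arrangement.
\<close>

definition \<alpha> :: "complex vec \<Rightarrow> complex vec" where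
  "\<alpha> t = vec n (\<lambda>j. a j / f_lin k b j z t)"

definition \<beta> :: "complex vec \<Rightarrow> complex vec" where
  "\<beta> p = vec k (\<lambda>m. \<Sum>l<k. B_inv m l * (a l / p $ l - z $ l))"

lemma \<alpha>_in_torus: "t \<in> U_compl k n b z \<Longrightarrow> \<alpha> t \<in> torus n"
  using a_nonzero by (auto simp: \<alpha>_def torus_def U_compl_def)

lemma \<beta>_carrier: "\<beta> p \<in> carrier_vec k"
  by (simp add: \<beta>_def)

lemma \<beta>_\<alpha>:
  assumes t: "t \<in> U_compl k n b z"
  shows "\<beta> (\<alpha> t) = t"
proof (rule eq_vecI)
  show "dim_vec (\<beta> (\<alpha> t)) = dim_vec t" using t by (auto simp: \<beta>_def U_compl_def)
  fix m assume "m < dim_vec t"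
  then have m: "m < k" using t by (auto simp: U_compl_def)
  have "a l / \<alpha> t $ l - z $ l = (\<Sum>r<k. b l r * t $ r)" if "l < k" for l
    using that t k_less a_nonzero[of l] by (auto simp: \<alpha>_def U_compl_def f_lin_def g_lin_def)
  then have "\<beta> (\<alpha> t) $ m = (\<Sum>l<k. B_inv m l * (\<Sum>r<k. b l r * t $ r))"
    using m by (auto simp: \<beta>_def intro!: sum.cong)
  also have "\<dots> = (\<Sum>l<k. \<Sum>r<k. B_inv m l * b l r * t $ r)"
    by (simp only: sum_distrib_left mult.assoc)
  also have "\<dots> = (\<Sum>r<k. (\<Sum>l<k. B_inv m l * b l r) * t $ r)"
    by (subst sum.swap) (simp only: sum_distrib_right)
  also have "\<dots> = (\<Sum>r<k. if r = m then t $ m else 0)"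
    using m by (intro sum.cong) (auto simp: B_inv_times_B)
  also have "\<dots> = t $ m" using m by simp
  finally show "\<beta> (\<alpha> t) $ m = t $ m" .
qed

lemma f_lin_\<beta>:
  assumes j: "j < k"
  shows "f_lin k b j z (\<beta> p) = a j / p $ j"
proof -
  let ?w = "\<lambda>l. a l / p $ l - z $ l"
  have "g_lin k b j (\<beta> p) = (\<Sum>m<k. b j m * (\<Sum>l<k. B_inv m l * ?w l))"
    by (auto simp: g_lin_def \<beta>_def intro!: sum.cong)
  also have "\<dots> = (\<Sum>m<k. \<Sum>l<k. b j m * B_inv m l * ?w l)"
    by (simp only: sum_distrib_left mult.assoc)
  also have "\<dots> = (\<Sum>l<k. (\<Sum>m<k. b j m * B_inv m l) * ?w l)"
    by (subst sum.swap) (simp only: sum_distrib_right)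
  also have "\<dots> = (\<Sum>l<k. if l = j then ?w j else 0)"
    using j by (intro sum.cong) (auto simp: B_times_B_inv)
  also have "\<dots> = ?w j" using j by simp
  finally show ?thesis by (simp add: f_lin_def)
qed

lemma F_large_\<alpha>:
  assumes t: "t \<in> U_compl k n b z" and "is": "length is = k + 1" "set is \<subseteq> {..<n}"
  shows "F_large k a b is z (\<alpha> t) = 0"
proof -
  have idx: "is ! m < n" if "m < k + 1" for m
    using subsetD[OF "is"(2) nth_mem[of m "is"]] "is"(1) that by simp
  have "\<alpha> t $ j \<noteq> 0" "f_lin k b j z t = a j / \<alpha> t $ j" if "j < n" for j
    using that t a_nonzero by (auto simp: \<alpha>_def U_compl_def)
  then show ?thesis using idx by (subst F_large_eq[OF "is"(1), of _ _ _ _ t]) auto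
qed

text \<open>
  At \<open>t = \<beta> p\<close> all summands of \<open>F_large_eq\<close> vanish except the one of the last index \<open>j\<close>.
\<close>

lemma F_large_\<beta>:
  assumes j: "j < n" and p: "p \<in> torus n"
  shows "F_large k a b ([0..<k] @ [j]) z p
    = (-1) ^ k * det B * (\<Prod>m<k+1. p $ (([0..<k] @ [j]) ! m)) * (f_lin k b j z (\<beta> p) - a j / p $ j)"
proof -
  let ?is = "[0..<k] @ [j]"
  have idx: "?is ! m < n" if "m < k + 1" for m
    using that j k_less by (auto simp: nth_append)
  have "(\<Sum>m<k+1. (-1) ^ m * d_minor k b (omit m ?is) * (f_lin k b (?is ! m) z (\<beta> p) - a (?is ! m) / p $ (?is ! m)))
    = (-1) ^ k * d_minor k b (omit k ?is) * (f_lin k b j z (\<beta> p) - a j / p $ j)"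
    by (simp add: nth_append f_lin_\<beta>)
  also have "omit k ?is = [0..<k]" by (simp add: omit_def)
  finally show ?thesis
    using p idx by (subst F_large_eq[where t = "\<beta> p"]) (auto simp: torus_def d_minor_upt)
qed

end

section \<open>Congruences of regular functions\<close>

lemma f_lin_polynomial: "f_lin k b j z \<in> polynomial_functions k"
proof -
  have "(\<lambda>t. \<Sum>m\<in>A. b j m * t $ m) \<in> polynomial_functions k" if "A \<subseteq> {..<k}" for A
    using finite_subset[OF that finite_lessThan] that
    by (induction A rule: finite_induct)
      (auto intro!: polynomial_functions.add polynomial_functions.mult
        intro: polynomial_functions.const polynomial_functions.coord)
  from polynomial_functions.add[OF polynomial_functions.const this[OF order.refl], of "z $ j"]
  show ?thesis by (simp add: f_lin_def[abs_def] g_lin_def)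
qed

lemma polynomial_functions_prod:
  "(\<And>i. i \<in> A \<Longrightarrow> P i \<in> polynomial_functions k) \<Longrightarrow> (\<lambda>t. \<Prod>i\<in>A. P i t) \<in> polynomial_functions k"
  by (induction A rule: infinite_finite_induct) (auto intro: polynomial_functions.intros)

lemma polynomial_functions_power:
  "P \<in> polynomial_functions k \<Longrightarrow> (\<lambda>t. P t ^ N) \<in> polynomial_functions k"
  by (induction N) (auto intro: polynomial_functions.intros)

lemma regular_on_power: "regular_on m X f \<Longrightarrow> regular_on m X (\<lambda>x. f x ^ N)"
  by (induction N) (auto intro: regular_on_const regular_on_mult)

lemma regular_on_prod:
  "(\<And>i. i \<in> A \<Longrightarrow> regular_on m X (f i)) \<Longrightarrow> regular_on m X (\<lambda>x. \<Prod>i\<in>A. f i x)"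
  by (induction A rule: infinite_finite_induct) (auto intro: regular_on_const regular_on_mult)

lemma regular_on_sum:
  "(\<And>i. i \<in> A \<Longrightarrow> regular_on m X (f i)) \<Longrightarrow> regular_on m X (\<lambda>x. \<Sum>i\<in>A. f i x)"
  by (induction A rule: infinite_finite_induct) (auto intro: regular_on_const regular_on_add)

definition cong_mod :: "complex vec set \<Rightarrow> (complex vec \<Rightarrow> complex) set
    \<Rightarrow> (complex vec \<Rightarrow> complex) \<Rightarrow> (complex vec \<Rightarrow> complex) \<Rightarrow> bool" where
  "cong_mod X K f g \<longleftrightarrow> restrict (\<lambda>x. f x - g x) X \<in> K"

lemma
  assumes K: "ideal K (regular_ring m X)"
  shows cong_mod_eq: "(\<And>x. x \<in> X \<Longrightarrow> f x = g x) \<Longrightarrow> cong_mod X K f g"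
    and cong_mod_add: "cong_mod X K f f' \<Longrightarrow> cong_mod X K g g'
      \<Longrightarrow> cong_mod X K (\<lambda>x. f x + g x) (\<lambda>x. f' x + g' x)"
    and cong_mod_mult: "cong_mod X K f f' \<Longrightarrow> cong_mod X K g g' \<Longrightarrow> regular_on m X f
      \<Longrightarrow> regular_on m X g' \<Longrightarrow> cong_mod X K (\<lambda>x. f x * g x) (\<lambda>x. f' x * g' x)"
proof -
  show "cong_mod X K f g" if "\<And>x. x \<in> X \<Longrightarrow> f x = g x"
    unfolding cong_mod_def using that by (intro ideal_restrict_zero[OF K]) simp
  show "cong_mod X K (\<lambda>x. f x + g x) (\<lambda>x. f' x + g' x)"
    if "cong_mod X K f f'" "cong_mod X K g g'"
    using ideal_restrict_add[OF K that[unfolded cong_mod_def]]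
    unfolding cong_mod_def by (rule ideal_restrict_cong) simp
  show "cong_mod X K (\<lambda>x. f x * g x) (\<lambda>x. f' x * g' x)"
    if "cong_mod X K f f'" "cong_mod X K g g'" "regular_on m X f" "regular_on m X g'"
    using ideal_restrict_add[OF K ideal_restrict_mult[OF K that(3) that(2)[unfolded cong_mod_def]]
        ideal_restrict_mult[OF K that(4) that(1)[unfolded cong_mod_def]]]
    unfolding cong_mod_def by (rule ideal_restrict_cong) (simp add: algebra_simps)
qed

lemma cong_mod_prod:
  assumes K: "ideal K (regular_ring m X)"
    and "\<And>i. i \<in> A \<Longrightarrow> cong_mod X K (f i) (g i)"
    and "\<And>i. i \<in> A \<Longrightarrow> regular_on m X (f i)" "\<And>i. i \<in> A \<Longrightarrow> regular_on m X (g i)"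
  shows "cong_mod X K (\<lambda>x. \<Prod>i\<in>A. f i x) (\<lambda>x. \<Prod>i\<in>A. g i x)"
  using assms(2-)
proof (induction A rule: infinite_finite_induct)
  case (insert i A)
  have "cong_mod X K (\<lambda>x. f i x * (\<Prod>i\<in>A. f i x)) (\<lambda>x. g i x * (\<Prod>i\<in>A. g i x))"
    by (rule cong_mod_mult[OF K]) (use insert in \<open>auto intro: regular_on_prod\<close>)
  then show ?case using insert.hyps by simp
qed (auto intro: cong_mod_eq[OF K])

lemma cong_mod_power:
  assumes "ideal K (regular_ring m X)" "cong_mod X K f g" "regular_on m X f" "regular_on m X g"
  shows "cong_mod X K (\<lambda>x. f x ^ N) (\<lambda>x. g x ^ N)"
  using cong_mod_prod[OF assms(1), of "{..<N}" "\<lambda>_. f" "\<lambda>_. g"] assms(2-) by simp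

section \<open>The pullback homomorphism\<close>

context generic_arrangement
begin

abbreviation "T \<equiv> torus n"
abbreviation "U \<equiv> U_compl k n b z"
abbreviation "f j \<equiv> f_lin k b j z"

lemma T_eq: "T = nonvanishing_locus n n (\<lambda>j p. p $ j)"
  by (simp add: torus_def nonvanishing_locus_def)

lemma U_eq: "U = nonvanishing_locus k n f"
  by (simp add: U_compl_def nonvanishing_locus_def)

lemma regular_on_T_coord: "j < n \<Longrightarrow> regular_on n T (\<lambda>p. p $ j)"
  by (intro regular_on_polynomial polynomial_functions.coord)

lemma regular_on_T_inverse: "j < n \<Longrightarrow> regular_on n T (\<lambda>p. 1 / p $ j)"
  by (intro regular_on_inverse polynomial_functions.coord) (auto simp: torus_def)

lemma regular_on_T_w: "j < n \<Longrightarrow> regular_on n T (\<lambda>p. a j / p $ j)"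
  using regular_on_cmult[OF regular_on_T_inverse] by simp

lemma regular_on_polynomial_\<beta>: "Q \<in> polynomial_functions k \<Longrightarrow> regular_on n T (\<lambda>p. Q (\<beta> p))"
proof (induction rule: polynomial_functions.induct)
  case (coord m)
  have "regular_on n T (\<lambda>p. \<Sum>l<k. B_inv m l * (a l / p $ l - z $ l))"
    using k_less by (intro regular_on_sum regular_on_cmult regular_on_diff regular_on_T_w regular_on_const) auto
  then show ?case using coord by (simp add: \<beta>_def)
qed (auto intro: regular_on_const regular_on_add regular_on_mult)

lemma regular_on_pullback:
  assumes "regular_on n T u"
  shows "regular_on k U (\<lambda>t. u (\<alpha> t))"
proof -
  obtain g where g: "g \<in> fun_alg (coords_and_inverses n n (\<lambda>j p. p $ j))" "\<And>p. p \<in> T \<Longrightarrow> u p = g p"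
    using regular_on_nonvanishing_locus[of n "\<lambda>j p. p $ j" n u] assms polynomial_functions.coord
    unfolding T_eq by blast
  have "regular_on k U (\<lambda>t. g (\<alpha> t))"
    using g(1)
  proof induction
    case (gen e)
    then consider j where "j < n" "e = (\<lambda>p. p $ j)" | j where "j < n" "e = (\<lambda>p. 1 / p $ j)"
      unfolding coords_and_inverses_def by blast
    then show ?case
    proof cases
      case 1
      have "regular_on k U (\<lambda>t. 1 / f j t)"
        using 1 by (intro regular_on_inverse f_lin_polynomial) (auto simp: U_compl_def)
      from regular_on_cmult[OF this, of "a j"] show ?thesis using 1 by (simp add: \<alpha>_def)
    next
      case 2
      from regular_on_cmult[OF regular_on_polynomial[OF f_lin_polynomial], of k U "1 / a j" b j z]
      show ?thesis using 2 by (simp add: \<alpha>_def)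
    qed
  qed (auto intro: regular_on_const regular_on_add regular_on_mult)
  moreover have "u (\<alpha> t) = g (\<alpha> t)" if "t \<in> U" for t by (rule g(2)[OF \<alpha>_in_torus[OF that]])
  ultimately show ?thesis using regular_on_cong[of U "\<lambda>t. u (\<alpha> t)" "\<lambda>t. g (\<alpha> t)"] by blast
qed

definition pullback :: "(complex vec \<Rightarrow> complex) \<Rightarrow> complex vec \<Rightarrow> complex" where
  "pullback u = restrict (\<lambda>t. u (\<alpha> t)) U"

lemma pullback_hom: "ring_hom_ring (O_torus n) (O_U k n b z) pullback"
  unfolding O_torus_def O_U_def
  by (intro ring_hom_ringI2 cring.axioms(1) regular_ring_cring)
    (use pullback_ring_hom[of U \<alpha> T n k] \<alpha>_in_torus regular_on_pullback in
      \<open>simp add: pullback_def[abs_def]\<close>)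

lemma pullback_restrict: "pullback (restrict g T) = restrict (\<lambda>t. g (\<alpha> t)) U"
  unfolding pullback_def using \<alpha>_in_torus by (intro restrict_ext) simp

lemma pullback_surj: "pullback ` carrier (O_torus n) = carrier (O_U k n b z)"
proof (intro equalityI subsetI)
  interpret ring_hom_ring "O_torus n" "O_U k n b z" pullback by (rule pullback_hom)
  fix v assume "v \<in> pullback ` carrier (O_torus n)"
  then show "v \<in> carrier (O_U k n b z)" by auto
next
  fix v assume "v \<in> carrier (O_U k n b z)"
  then obtain v' where v': "v = restrict v' U" "regular_on k U v'"
    unfolding O_U_def by (rule regular_ringE)
  obtain g where g: "g \<in> fun_alg (coords_and_inverses k n f)" "\<And>t. t \<in> U \<Longrightarrow> v' t = g t"
    using regular_on_nonvanishing_locus[of n f k v'] v'(2) f_lin_polynomial unfolding U_eq by blast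
  have "\<exists>u. regular_on n T u \<and> (\<forall>t\<in>U. u (\<alpha> t) = g t)"
    using g(1)
  proof induction
    case (const c)
    show ?case by (intro exI[of _ "\<lambda>_. c"]) (simp add: regular_on_const)
  next
    case (gen e)
    then consider i where "i < k" "e = (\<lambda>t. t $ i)" | j where "j < n" "e = (\<lambda>t. 1 / f j t)"
      unfolding coords_and_inverses_def by blast
    then show ?case
    proof cases
      case 1
      from regular_on_polynomial_\<beta>[OF polynomial_functions.coord[OF 1(1)]] show ?thesis
        using 1 by (intro exI[of _ "\<lambda>p. \<beta> p $ i"]) (simp add: \<beta>_\<alpha>)
    next
      case 2
      from regular_on_cmult[OF regular_on_T_coord[OF 2(1)], of "1 / a j"] show ?thesis
        using 2 a_nonzero by (intro exI[of _ "\<lambda>p. 1 / a j * p $ j"]) (simp add: \<alpha>_def)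
    qed
  next
    case (add g g')
    then obtain u u' where "regular_on n T u" "\<forall>t\<in>U. u (\<alpha> t) = g t"
      "regular_on n T u'" "\<forall>t\<in>U. u' (\<alpha> t) = g' t" by blast
    then show ?case by (intro exI[of _ "\<lambda>p. u p + u' p"]) (simp add: regular_on_add)
  next
    case (mult g g')
    then obtain u u' where "regular_on n T u" "\<forall>t\<in>U. u (\<alpha> t) = g t"
      "regular_on n T u'" "\<forall>t\<in>U. u' (\<alpha> t) = g' t" by blast
    then show ?case by (intro exI[of _ "\<lambda>p. u p * u' p"]) (simp add: regular_on_mult)
  qed
  then obtain u where u: "regular_on n T u" "\<And>t. t \<in> U \<Longrightarrow> u (\<alpha> t) = g t" by blast
  have "pullback (restrict u T) = v"
    unfolding pullback_restrict v'(1) by (rule restrict_ext) (simp add: u(2) g(2))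
  moreover have "restrict u T \<in> carrier (O_torus n)" using u(1) by (simp add: O_torus_def)
  ultimately show "v \<in> pullback ` carrier (O_torus n)" by (rule image_eqI[OF sym])
qed

text \<open>
  Modulo \<open>N\<close> every \<open>a j / p $ j\<close> is a polynomial in \<open>\<beta> p\<close>, so every regular function \<open>u\<close> on the torus
  becomes congruent to some polynomial \<open>Q (\<beta> p)\<close> after multiplication by a power of
  \<open>W\<close>, the product of all \<open>a j / p $ j\<close>. If \<open>u\<close> vanishes on the image of \<open>\<alpha>\<close>, then \<open>Q\<close> vanishes
  on the complement of the arrangement. Multiplied by the product \<open>F\<close> of all \<open>f j\<close> it vanishes
  everywhere, and \<open>F (\<beta> p)\<close> is congruent to the unit \<open>W\<close>.
\<close>

lemma vanishing_pullback_in_ideal: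
  assumes N: "ideal N (regular_ring n T)"
    and w: "\<And>j. j < n \<Longrightarrow> cong_mod T N (\<lambda>p. a j / p $ j) (\<lambda>p. f j (\<beta> p))"
    and N_vanish: "\<And>v t. restrict v T \<in> N \<Longrightarrow> t \<in> U \<Longrightarrow> v (\<alpha> t) = 0"
    and u: "regular_on n T u" and u_vanish: "\<And>t. t \<in> U \<Longrightarrow> u (\<alpha> t) = 0"
  shows "restrict u T \<in> N"
proof -
  define W where "W p = (\<Prod>j<n. a j / p $ j)" for p :: "complex vec"
  define F where "F t = (\<Prod>j<n. f j t)" for t
  have F: "F \<in> polynomial_functions k"
    unfolding F_def[abs_def] by (intro polynomial_functions_prod f_lin_polynomial)
  have W: "regular_on n T W" unfolding W_def[abs_def]
    by (intro regular_on_prod regular_on_T_w) simp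
  note reg = regular_on_polynomial_\<beta> regular_on_power regular_on_mult regular_on_const W F
    polynomial_functions_power
  have WF: "cong_mod T N (\<lambda>p. W p ^ M) (\<lambda>p. F (\<beta> p) ^ M)" for M
  proof (rule cong_mod_power[OF N _ W regular_on_polynomial_\<beta>[OF F]])
    show "cong_mod T N W (\<lambda>p. F (\<beta> p))"
      unfolding W_def[abs_def] F_def
      by (intro cong_mod_prod[OF N] w regular_on_T_w regular_on_polynomial_\<beta> f_lin_polynomial) simp_all
  qed
  obtain g where g: "g \<in> fun_alg (coords_and_inverses n n (\<lambda>j p. p $ j))" "\<And>p. p \<in> T \<Longrightarrow> u p = g p"
    using regular_on_nonvanishing_locus[of n "\<lambda>j p. p $ j" n u] u polynomial_functions.coord
    unfolding T_eq by blast
  have reg_g: "regular_on n T g" if "g \<in> fun_alg (coords_and_inverses n n (\<lambda>j p. p $ j))" for g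
    unfolding T_eq using that polynomial_functions.coord by (intro regular_on_fun_alg)
  have "\<exists>M. \<exists>Q\<in>polynomial_functions k. cong_mod T N (\<lambda>p. W p ^ M * g p) (\<lambda>p. Q (\<beta> p))"
    using g(1)
  proof induction
    case (const c)
    show ?case
      by (intro exI[of _ 0] bexI[OF _ polynomial_functions.const[of c]]) (simp add: cong_mod_eq[OF N])
  next
    case (gen e)
    then consider j where "j < n" "e = (\<lambda>p. p $ j)" | j where "j < n" "e = (\<lambda>p. 1 / p $ j)"
      unfolding coords_and_inverses_def by blast
    then show ?case
    proof cases
      case 1
      \<comment> \<open>The factor \<open>a j / p $ j\<close> of \<open>W\<close> cancels \<open>p $ j\<close>.\<close>
      define Q where "Q t = a j * (\<Prod>i\<in>{..<n} - {j}. f i t)" for t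
      have Q: "Q \<in> polynomial_functions k" unfolding Q_def[abs_def]
        by (intro polynomial_functions.mult polynomial_functions.const polynomial_functions_prod f_lin_polynomial)
      have "cong_mod T N (\<lambda>p. a j * (\<Prod>i\<in>{..<n} - {j}. a i / p $ i)) (\<lambda>p. Q (\<beta> p))"
        unfolding Q_def
        by (intro cong_mod_mult[OF N] cong_mod_prod[OF N] cong_mod_eq[OF N] w regular_on_T_w
            regular_on_polynomial_\<beta> f_lin_polynomial regular_on_const regular_on_prod) simp_all
      then have "cong_mod T N (\<lambda>p. W p ^ 1 * p $ j) (\<lambda>p. Q (\<beta> p))"
        unfolding cong_mod_def
      proof (rule ideal_restrict_cong)
        fix p assume "p \<in> T"
        then have "p $ j \<noteq> 0" using 1 by (simp add: torus_def)
        moreover have "W p = a j / p $ j * (\<Prod>i\<in>{..<n} - {j}. a i / p $ i)"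
          unfolding W_def using 1 by (intro prod.remove) auto
        ultimately show "a j * (\<Prod>i\<in>{..<n} - {j}. a i / p $ i) - Q (\<beta> p) = W p ^ 1 * p $ j - Q (\<beta> p)"
          by simp
      qed
      then show ?thesis unfolding 1(2) by (intro exI[of _ 1] bexI[OF _ Q])
    next
      case 2
      have Q: "(\<lambda>t. 1 / a j * f j t) \<in> polynomial_functions k"
        by (intro polynomial_functions.mult polynomial_functions.const f_lin_polynomial)
      have "cong_mod T N (\<lambda>p. 1 / a j * (a j / p $ j)) (\<lambda>p. 1 / a j * f j (\<beta> p))"
        by (intro cong_mod_mult[OF N] cong_mod_eq[OF N] w regular_on_polynomial_\<beta> f_lin_polynomial
            regular_on_const 2 refl)
      moreover have "(\<lambda>p. 1 / a j * (a j / p $ j)) = (\<lambda>p. W p ^ 0 * (1 / p $ j))"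
        using a_nonzero[OF 2(1)] by (intro ext) simp
      ultimately have "cong_mod T N (\<lambda>p. W p ^ 0 * (1 / p $ j)) (\<lambda>p. 1 / a j * f j (\<beta> p))" by (simp only:)
      then show ?thesis unfolding 2(2) by (intro exI[of _ 0] bexI[OF _ Q])
    qed
  next
    case (add g g')
    then obtain M M' Q Q' where Q: "Q \<in> polynomial_functions k" "Q' \<in> polynomial_functions k"
      and c: "cong_mod T N (\<lambda>p. W p ^ M * g p) (\<lambda>p. Q (\<beta> p))"
        "cong_mod T N (\<lambda>p. W p ^ M' * g' p) (\<lambda>p. Q' (\<beta> p))" by blast
    \<comment> \<open>Bring both to the common power \<open>M + M'\<close>, using that \<open>W\<close> is congruent to \<open>F (\<beta> p)\<close>.\<close>
    have Q'': "(\<lambda>t. F t ^ M' * Q t + F t ^ M * Q' t) \<in> polynomial_functions k"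
      by (intro polynomial_functions.add polynomial_functions.mult polynomial_functions_power F Q)
    have "cong_mod T N (\<lambda>p. W p ^ M' * (W p ^ M * g p) + W p ^ M * (W p ^ M' * g' p))
        (\<lambda>p. F (\<beta> p) ^ M' * Q (\<beta> p) + F (\<beta> p) ^ M * Q' (\<beta> p))"
      by (intro cong_mod_add[OF N] cong_mod_mult[OF N] WF c reg Q)
    also have "(\<lambda>p. W p ^ M' * (W p ^ M * g p) + W p ^ M * (W p ^ M' * g' p))
        = (\<lambda>p. W p ^ (M + M') * (g p + g' p))"
      by (rule ext) (simp add: power_add algebra_simps)
    finally show ?case by (intro exI[of _ "M + M'"] bexI[OF _ Q''])
  next
    case (mult g g')
    then obtain M M' Q Q' where Q: "Q \<in> polynomial_functions k" "Q' \<in> polynomial_functions k"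
      and c: "cong_mod T N (\<lambda>p. W p ^ M * g p) (\<lambda>p. Q (\<beta> p))"
        "cong_mod T N (\<lambda>p. W p ^ M' * g' p) (\<lambda>p. Q' (\<beta> p))" by blast
    have "cong_mod T N (\<lambda>p. (W p ^ M * g p) * (W p ^ M' * g' p)) (\<lambda>p. Q (\<beta> p) * Q' (\<beta> p))"
      by (intro cong_mod_mult[OF N] c reg Q reg_g mult.hyps)
    also have "(\<lambda>p. (W p ^ M * g p) * (W p ^ M' * g' p)) = (\<lambda>p. W p ^ (M + M') * (g p * g' p))"
      by (rule ext) (simp add: power_add algebra_simps)
    finally show ?case by (intro exI[of _ "M + M'"] bexI[OF _ polynomial_functions.mult[OF Q]])
  qed
  then obtain M Q where Q: "Q \<in> polynomial_functions k"
    and c: "cong_mod T N (\<lambda>p. W p ^ M * g p) (\<lambda>p. Q (\<beta> p))" by blast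
  have "Q t * F t = 0" if t: "t \<in> carrier_vec k" for t
  proof (cases "t \<in> U")
    case True
    have "W (\<alpha> t) ^ M * g (\<alpha> t) - Q (\<beta> (\<alpha> t)) = 0"
      by (rule N_vanish[OF c[unfolded cong_mod_def] True])
    moreover have "g (\<alpha> t) = 0" using u_vanish[OF True] g(2)[OF \<alpha>_in_torus[OF True]] by simp
    ultimately show ?thesis by (simp add: \<beta>_\<alpha>[OF True])
  next
    case False
    then show ?thesis using t by (auto simp: F_def U_compl_def)
  qed
  then have QF: "Q (\<beta> p) * F (\<beta> p) = 0" for p by (simp add: \<beta>_carrier)
  have "cong_mod T N (\<lambda>p. (W p ^ M * g p) * W p ^ 1) (\<lambda>p. Q (\<beta> p) * F (\<beta> p) ^ 1)"
    by (intro cong_mod_mult[OF N] c WF reg Q reg_g g(1))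
  then have WN: "restrict (\<lambda>p. (W p ^ M * g p) * W p) T \<in> N"
    unfolding cong_mod_def by (simp only: power_one_right QF diff_zero)
  have W_inv: "regular_on n T (\<lambda>p. (\<Prod>j<n. 1 / a j * p $ j) ^ Suc M)"
    by (intro regular_on_power regular_on_prod regular_on_cmult regular_on_T_coord) simp
  from ideal_restrict_mult[OF N W_inv WN] show "restrict u T \<in> N"
  proof (rule ideal_restrict_cong)
    fix p assume p: "p \<in> T"
    have "(\<Prod>j<n. 1 / a j * p $ j) * W p = 1"
      unfolding W_def prod.distrib[symmetric] using p a_nonzero
      by (intro prod.neutral) (auto simp: torus_def)
    moreover have "(\<Prod>j<n. 1 / a j * p $ j) ^ Suc M * ((W p ^ M * g p) * W p)
      = ((\<Prod>j<n. 1 / a j * p $ j) * W p) ^ Suc M * g p"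
      by (simp only: power_mult_distrib) simp
    ultimately show "(\<Prod>j<n. 1 / a j * p $ j) ^ Suc M * ((W p ^ M * g p) * W p) = u p"
      using g(2)[OF p] by simp
  qed
qed

section \<open>The two ideals\<close>

abbreviation "I\<^sub>t \<equiv> I_tilde k n a b z"
abbreviation "I\<^sub>\<Phi> \<equiv> I_Phi k n a b z"

lemma regular_on_F_small: "regular_on n T (F_small k n b is)"
  unfolding F_small_def[abs_def]
  by (intro regular_on_sum regular_on_cmult regular_on_T_coord) simp

lemma regular_on_F_large:
  assumes "length is = k + 1" "set is \<subseteq> {..<n}"
  shows "regular_on n T (F_large k a b is z)"
proof -
  have idx: "is ! m < n" if "m < k + 1" for m
    using subsetD[OF assms(2) nth_mem[of m "is"]] assms(1) that by simp
  show ?thesis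
    unfolding F_large_def[abs_def]
    by (intro regular_on_add regular_on_sum regular_on_mult regular_on_const regular_on_prod
        regular_on_T_coord idx) simp_all
qed

lemma sorted_list_of_index_set:
  assumes "I \<subseteq> {..<n}"
  shows "length (sorted_list_of_set I) = card I" "set (sorted_list_of_set I) \<subseteq> {..<n}"
  using assms finite_subset[OF assms finite_lessThan] by simp_all

lemma I_tilde_generators_carrier:
  "{restrict (F_small k n b (sorted_list_of_set I)) T |I. I \<subseteq> {..<n} \<and> card I = k - 1}
     \<union> {restrict (F_large k a b (sorted_list_of_set I) z) T |I. I \<subseteq> {..<n} \<and> card I = k + 1}
   \<subseteq> carrier (O_torus n)" (is "?S \<union> ?L \<subseteq> _")
proof -
  have "?S \<subseteq> carrier (O_torus n)" by (auto simp: O_torus_def regular_on_F_small)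
  moreover have "?L \<subseteq> carrier (O_torus n)"
    by (auto simp: O_torus_def intro!: regular_on_F_large sorted_list_of_index_set(2))
  ultimately show ?thesis by (rule Un_least)
qed

lemma
  shows I_tilde_ideal: "ideal I\<^sub>t (O_torus n)"
    and F_small_in_I_tilde: "I \<subseteq> {..<n} \<Longrightarrow> card I = k - 1
      \<Longrightarrow> restrict (F_small k n b (sorted_list_of_set I)) T \<in> I\<^sub>t"
    and F_large_in_I_tilde: "I \<subseteq> {..<n} \<Longrightarrow> card I = k + 1
      \<Longrightarrow> restrict (F_large k a b (sorted_list_of_set I) z) T \<in> I\<^sub>t"
proof -
  interpret cring "O_torus n" unfolding O_torus_def by (rule regular_ring_cring)
  show "ideal I\<^sub>t (O_torus n)"
    unfolding I_tilde_def by (rule genideal_ideal[OF I_tilde_generators_carrier])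
  note self = subsetD[OF genideal_self[OF I_tilde_generators_carrier]]
  show "restrict (F_small k n b (sorted_list_of_set I)) T \<in> I\<^sub>t"
    if "I \<subseteq> {..<n}" "card I = k - 1" for I
    unfolding I_tilde_def using that by (intro self UnI1) blast
  show "restrict (F_large k a b (sorted_list_of_set I) z) T \<in> I\<^sub>t"
    if "I \<subseteq> {..<n}" "card I = k + 1" for I
    unfolding I_tilde_def using that by (intro self UnI2) blast
qed

lemma dPhi_eq_pullback: "dPhi k n a b z i t = dPhi_lin n b i (\<alpha> t)"
  by (simp add: dPhi_def dPhi_lin_def \<alpha>_def)

lemma I_Phi_generators_carrier:
  "{restrict (dPhi k n a b z i) U |i. i < k} \<subseteq> carrier (O_U k n b z)"
proof -
  have "regular_on k U (\<lambda>t. b j i * (a j * (1 / f j t)))" if "j < n" for i j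
    using that by (intro regular_on_cmult regular_on_inverse f_lin_polynomial) (simp add: U_compl_def)
  then have "regular_on k U (dPhi k n a b z i)" for i
    unfolding dPhi_def[abs_def] by (intro regular_on_sum) simp
  then show ?thesis by (auto simp: O_U_def)
qed

lemma
  shows I_Phi_ideal: "ideal I\<^sub>\<Phi> (O_U k n b z)"
    and dPhi_in_I_Phi: "i < k \<Longrightarrow> restrict (dPhi k n a b z i) U \<in> I\<^sub>\<Phi>"
proof -
  interpret cring "O_U k n b z" unfolding O_U_def by (rule regular_ring_cring)
  show "ideal I\<^sub>\<Phi> (O_U k n b z)"
    unfolding I_Phi_def by (rule genideal_ideal[OF I_Phi_generators_carrier])
  show "restrict (dPhi k n a b z i) U \<in> I\<^sub>\<Phi>" if "i < k" for i
    unfolding I_Phi_def using that by (intro subsetD[OF genideal_self[OF I_Phi_generators_carrier]]) blast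
qed

text \<open>
  The pullbacks of the \<open>F_large\<close> are zero, those of the \<open>F_small\<close> are combinations of the partial
  derivatives, and by inversion of \<open>B\<close> the partial derivatives are combinations of the latter. The
  image of an ideal is an ideal since the pullback is surjective.
\<close>

lemma pullback_I_tilde: "pullback ` I\<^sub>t = I\<^sub>\<Phi>"
proof (rule equalityI)
  interpret h: ring_hom_ring "O_torus n" "O_U k n b z" pullback by (rule pullback_hom)
  define K where "K = {u \<in> carrier (O_torus n). pullback u \<in> I\<^sub>\<Phi>}"
  have "ideal K (O_torus n)" unfolding K_def by (rule h.ideal_vimage[OF I_Phi_ideal])
  have "pullback (restrict (F_small k n b is) T) \<in> I\<^sub>\<Phi>" for "is"
  proof -
    let ?c = "\<lambda>m. (-1) ^ m * det (mat (k-1) (k-1) (\<lambda>(l, c). b (is ! l) (if c < m then c else Suc c)))"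
    note I = I_Phi_ideal[unfolded O_U_def]
    have "restrict (\<lambda>t. \<Sum>m<k. ?c m * dPhi k n a b z m t) U \<in> I\<^sub>\<Phi>"
      by (intro ideal_restrict_sum[OF I] ideal_restrict_mult[OF I] regular_on_const dPhi_in_I_Phi) simp
    then show ?thesis
      unfolding pullback_restrict F_small_eq[OF k_pos] dPhi_eq_pullback .
  qed
  moreover have "pullback (restrict (F_large k a b (sorted_list_of_set I) z) T) \<in> I\<^sub>\<Phi>"
    if "I \<subseteq> {..<n}" "card I = k + 1" for I
    unfolding pullback_restrict
    by (rule ideal_restrict_zero[OF I_Phi_ideal[unfolded O_U_def]], rule F_large_\<alpha>)
      (use that sorted_list_of_index_set in auto)
  ultimately have "I\<^sub>t \<subseteq> K"
    unfolding I_tilde_def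
    by (intro h.R.genideal_minimal[OF \<open>ideal K _\<close>]) (use I_tilde_generators_carrier in \<open>auto simp: K_def\<close>)
  then show "pullback ` I\<^sub>t \<subseteq> I\<^sub>\<Phi>" by (auto simp: K_def)
  have "restrict (dPhi k n a b z i) U \<in> pullback ` I\<^sub>t" if i: "i < k" for i
  proof
    note I = I_tilde_ideal[unfolded O_torus_def]
    have "restrict (F_small k n b (omit l [0..<k])) T \<in> I\<^sub>t" if l: "l < k" for l
    proof -
      have "sorted_list_of_set ({..<k} - {l}) = omit l [0..<k]"
      proof -
        have "omit l [0..<k] = [0..<l] @ [Suc l..<k]"
          using l by (simp add: omit_def take_upt drop_upt)
        moreover have "{..<k} - {l} = set ([0..<l] @ [Suc l..<k])" using l by auto
        moreover have "sorted ([0..<l] @ [Suc l..<k])" "distinct ([0..<l] @ [Suc l..<k])"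
          by (auto simp: sorted_append)
        ultimately show ?thesis by (simp only: sorted_list_of_set.idem_if_sorted_distinct)
      qed
      moreover have "card ({..<k} - {l}) = k - 1" "{..<k} - {l} \<subseteq> {..<n}" using l k_less by auto
      ultimately show ?thesis using F_small_in_I_tilde[of "{..<k} - {l}"] by simp
    qed
    then have "restrict (\<lambda>p. \<Sum>l<k. (b l i * (-1) ^ l / det B) * F_small k n b (omit l [0..<k]) p) T \<in> I\<^sub>t"
      by (intro ideal_restrict_sum[OF I] ideal_restrict_mult[OF I] regular_on_const) simp
    then show "restrict (dPhi_lin n b i) T \<in> I\<^sub>t"
      by (rule ideal_restrict_cong) (simp add: dPhi_lin_eq_F_small[OF i])
    show "restrict (dPhi k n a b z i) U = pullback (restrict (dPhi_lin n b i) T)"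
      unfolding pullback_restrict dPhi_eq_pullback ..
  qed
  then show "I\<^sub>\<Phi> \<subseteq> pullback ` I\<^sub>t"
    unfolding I_Phi_def
    by (intro h.S.genideal_minimal ideal_image_surj[OF pullback_hom pullback_surj I_tilde_ideal]) blast
qed

text \<open>
  The lemma \<open>vanishing_pullback_in_ideal\<close> is applied to the ideal \<open>N\<close> of elements of \<open>I\<^sub>t\<close>
  with zero pullback. The \<open>F_large\<close> of the index set \<open>{..<k} \<union> {j}\<close> makes \<open>a j / p $ j\<close> congruent to
  \<open>f j (\<beta> p)\<close>, because it is a unit multiple of the difference.
\<close>

lemma kernel_pullback_subset: "a_kernel (O_torus n) (O_U k n b z) pullback \<subseteq> I\<^sub>t"
proof
  interpret h: ring_hom_ring "O_torus n" "O_U k n b z" pullback by (rule pullback_hom)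
  let ?K = "a_kernel (O_torus n) (O_U k n b z) pullback"
  have in_kernel: "restrict v T \<in> ?K \<longleftrightarrow> regular_on n T v \<and> (\<forall>t\<in>U. v (\<alpha> t) = 0)" for v
  proof -
    have "restrict (\<lambda>t. v (\<alpha> t)) U = restrict (\<lambda>t. 0) U \<longleftrightarrow> (\<forall>t\<in>U. v (\<alpha> t) = 0)"
      by (simp add: fun_eq_iff restrict_def Ball_def)
    then show ?thesis
      unfolding a_kernel_def' mem_Collect_eq pullback_restrict O_torus_def O_U_def regular_ring_zero
        restrict_in_regular_ring by (simp only:)
  qed
  have N: "ideal (I\<^sub>t \<inter> ?K) (regular_ring n T)"
    unfolding O_torus_def[symmetric]
    by (rule h.R.i_intersect[OF I_tilde_ideal h.kernel_is_ideal])
  have w: "cong_mod T (I\<^sub>t \<inter> ?K) (\<lambda>p. a j / p $ j) (\<lambda>p. f j (\<beta> p))" if j: "j < n" for j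
  proof (cases "j < k")
    case True
    then show ?thesis by (intro cong_mod_eq[OF N]) (simp add: f_lin_\<beta>)
  next
    case False
    let ?is = "[0..<k] @ [j]"
    have "is": "length ?is = k + 1" "set ?is \<subseteq> {..<n}" using j k_less by auto
    have "sorted_list_of_set (set ?is) = ?is"
      using False by (intro sorted_list_of_set.idem_if_sorted_distinct) (auto simp: sorted_append)
    moreover have "card (set ?is) = k + 1"
      using False by (subst distinct_card) auto
    ultimately have "restrict (F_large k a b ?is z) T \<in> I\<^sub>t"
      using F_large_in_I_tilde[OF "is"(2)] by (simp only:)
    moreover have "restrict (F_large k a b ?is z) T \<in> ?K"
      unfolding in_kernel using regular_on_F_large[OF "is"] F_large_\<alpha>[OF _ "is"] by blast
    ultimately have L: "restrict (F_large k a b ?is z) T \<in> I\<^sub>t \<inter> ?K" by (rule IntI)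
    have idx: "?is ! m < n" if "m < k + 1" for m
      using that j k_less by (auto simp: nth_append)
    \<comment> \<open>The inverse, up to sign, of the unit factor in \<open>F_large_\<beta>\<close>.\<close>
    have "regular_on n T (\<lambda>p. (- ((-1) ^ k) / det B) * (\<Prod>m<k+1. 1 / p $ (?is ! m)))"
      by (intro regular_on_cmult regular_on_prod regular_on_T_inverse idx) simp
    from ideal_restrict_mult[OF N this L] show ?thesis
      unfolding cong_mod_def
    proof (rule ideal_restrict_cong)
      fix p assume p: "p \<in> T"
      have "(\<Prod>m<k+1. 1 / p $ (?is ! m)) * (\<Prod>m<k+1. p $ (?is ! m)) = 1"
        unfolding prod.distrib[symmetric] using p idx by (intro prod.neutral) (auto simp: torus_def)
      moreover have "(- ((-1) ^ k) / det B) * P * ((-1) ^ k * det B * P' * (x - y)) = (P * P') * (y - x)"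
        for P P' x y :: complex
      proof -
        have eq: "(- s / D) * P * (s * D * P' * (x - y)) = (s * s) * ((P * P') * (y - x))"
          if "D \<noteq> 0" for s D :: complex
          using that by (simp add: field_simps)
        have sq: "(-1 :: complex) ^ k * (-1) ^ k = 1" by (simp flip: power_mult_distrib)
        show ?thesis unfolding eq[OF det_B] sq mult_1_left ..
      qed
      ultimately show "(- ((-1) ^ k) / det B) * (\<Prod>m<k+1. 1 / p $ (?is ! m)) * F_large k a b ?is z p
        = a j / p $ j - f j (\<beta> p)"
        unfolding F_large_\<beta>[OF j p] by (simp only: mult_1_left)
    qed
  qed
  fix u assume u: "u \<in> ?K"
  then have "u \<in> carrier (regular_ring n T)"
    unfolding a_kernel_def' O_torus_def by (elim CollectE conjE)
  then obtain v where v: "u = restrict v T" "regular_on n T v" by (rule regular_ringE)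
  have "restrict v T \<in> I\<^sub>t \<inter> ?K"
  proof (rule vanishing_pullback_in_ideal[OF N w _ v(2)])
    show "v' (\<alpha> t) = 0" if "restrict v' T \<in> I\<^sub>t \<inter> ?K" "t \<in> U" for v' t
      using IntD2[OF that(1)] that(2) unfolding in_kernel by blast
    show "v (\<alpha> t) = 0" if "t \<in> U" for t
      using u that unfolding v(1) in_kernel by blast
  qed
  then show "u \<in> I\<^sub>t" by (simp add: v(1))
qed

section \<open>The natural isomorphism\<close>

lemma natural_hom_exists_iso:
  "\<exists>\<phi>\<in>ring_iso (A_tilde k n a b z) (A_Phi k n a b z). natural_hom k n a b z \<phi>"
proof -
  from quotient_ring_iso[OF pullback_hom pullback_surj I_tilde_ideal I_Phi_ideal pullback_I_tilde
      kernel_pullback_subset]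
  obtain \<phi> where coset:
      "\<forall>x\<in>carrier (O_torus n). \<phi> (I\<^sub>t +>\<^bsub>O_torus n\<^esub> x) = I\<^sub>\<Phi> +>\<^bsub>O_U k n b z\<^esub> pullback x"
    and iso: "\<phi> \<in> ring_iso (A_tilde k n a b z) (A_Phi k n a b z)"
    unfolding A_tilde_def A_Phi_def ..
  have on_class: "\<phi> (class_tilde k n a b z g) = class_Phi k n a b z (\<lambda>t. g (\<alpha> t))"
    if "regular_on n T g" for g
    unfolding class_tilde_def class_Phi_def pullback_restrict[symmetric]
    using that by (intro bspec[OF coset]) (simp add: O_torus_def)
  have "natural_hom k n a b z \<phi>"
    unfolding natural_hom_def
  proof (intro conjI allI impI)
    show "\<phi> \<in> ring_hom (A_tilde k n a b z) (A_Phi k n a b z)"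
      using iso by (simp add: ring_iso_def)
    show "\<phi> (class_tilde k n a b z (\<lambda>p. c)) = class_Phi k n a b z (\<lambda>t. c)" for c
      by (rule on_class[OF regular_on_const])
    show "\<phi> (class_tilde k n a b z (\<lambda>p. p $ j)) = class_Phi k n a b z (\<lambda>t. a j / f j t)"
      if "j < n" for j
      using on_class[OF regular_on_T_coord[OF that]] that by (simp add: \<alpha>_def)
  qed
  then show ?thesis using iso by (rule bexI)
qed

text \<open>
  Composed with the projection, a natural homomorphism becomes a homomorphism on the ring of regular
  functions on the torus with prescribed values on constants and coordinates.
\<close>

lemma natural_hom_unique:
  assumes h: "natural_hom k n a b z h" and h': "natural_hom k n a b z h'"
    and x: "x \<in> carrier (A_tilde k n a b z)"
  shows "h x = h' x"
proof -
  interpret I: ideal I\<^sub>t "O_torus n" by (rule I_tilde_ideal)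
  let ?q = "\<lambda>u. I\<^sub>t +>\<^bsub>O_torus n\<^esub> u"
  have comp: "h \<circ> ?q \<in> ring_hom (regular_ring n T) (A_Phi k n a b z)" if "natural_hom k n a b z h" for h
  proof -
    have "h \<in> ring_hom (O_torus n Quot I\<^sub>t) (A_Phi k n a b z)"
      using that unfolding natural_hom_def A_tilde_def by (rule conjunct1)
    then show ?thesis
      unfolding O_torus_def[symmetric] by (rule ring_hom_trans[OF I.rcos_ring_hom])
  qed
  have cring: "cring (A_Phi k n a b z)"
    unfolding A_Phi_def O_U_def
    by (rule ideal.quotient_is_cring[OF I_Phi_ideal[unfolded O_U_def] regular_ring_cring])
  from x obtain u where u: "u \<in> carrier (O_torus n)" "x = ?q u"
    by (auto simp: A_tilde_def FactRing_def A_RCOSETS_def')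
  have const: "h (?q (restrict (\<lambda>p. c) T)) = class_Phi k n a b z (\<lambda>t. c)"
    and coord: "j < n \<Longrightarrow> h (?q (restrict (\<lambda>p. p $ j) T)) = class_Phi k n a b z (\<lambda>t. a j / f j t)"
    if "natural_hom k n a b z h" for h c j
    using that unfolding natural_hom_def class_tilde_def by blast+
  have "(h \<circ> ?q) u = (h' \<circ> ?q) u"
  proof (rule ring_hom_eq_on_regular_ring[of n "\<lambda>j p. p $ j" n, folded T_eq,
        OF _ cring comp[OF h] comp[OF h']])
    show "u \<in> carrier (regular_ring n T)" using u(1) by (simp only: O_torus_def)
  qed (simp_all only: comp_apply const[OF h] const[OF h'] coord[OF h] coord[OF h']
      polynomial_functions.coord)
  then show ?thesis by (simp only: u(2) comp_apply)
qed

end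

theorem theorem2p4:
  fixes k n :: nat
    and a :: "nat \<Rightarrow> complex"
    and b :: "nat \<Rightarrow> nat \<Rightarrow> complex"
    and z :: "complex vec"
  assumes "0 < k" and "k < n"
    and "\<And>is. length is = k \<Longrightarrow> distinct is \<Longrightarrow> set is \<subseteq> {..<n} \<Longrightarrow> d_minor k b is \<noteq> 0"
    and "\<And>j. j < n \<Longrightarrow> a j \<noteq> 0"
    and "(\<Sum>j<n. a j) \<noteq> 0"
    and "z \<in> carrier_vec n - Discr k n b"
  shows "(\<exists>h. natural_hom k n a b z h)
    \<and> (\<forall>h h'. natural_hom k n a b z h \<longrightarrow> natural_hom k n a b z h' \<longrightarrow>
          (\<forall>x \<in> carrier (A_tilde k n a b z). h x = h' x))
    \<and> (\<forall>h. natural_hom k n a b z h \<longrightarrow> h \<in> ring_iso (A_tilde k n a b z) (A_Phi k n a b z))"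
proof -
  interpret generic_arrangement k n a b z
    by unfold_locales (fact assms(1-4))+
  obtain \<phi> where \<phi>: "\<phi> \<in> ring_iso (A_tilde k n a b z) (A_Phi k n a b z)" "natural_hom k n a b z \<phi>"
    using natural_hom_exists_iso by (rule bexE)
  have iso: "h \<in> ring_iso (A_tilde k n a b z) (A_Phi k n a b z)" if h: "natural_hom k n a b z h" for h
  proof -
    have "bij_betw \<phi> (carrier (A_tilde k n a b z)) (carrier (A_Phi k n a b z))"
      using \<phi>(1) by (simp add: ring_iso_def)
    moreover have "bij_betw h (carrier (A_tilde k n a b z)) (carrier (A_Phi k n a b z))
        = bij_betw \<phi> (carrier (A_tilde k n a b z)) (carrier (A_Phi k n a b z))"
      by (rule bij_betw_cong) (rule natural_hom_unique[OF h \<phi>(2)])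
    ultimately have "bij_betw h (carrier (A_tilde k n a b z)) (carrier (A_Phi k n a b z))"
      by (simp only:)
    then show ?thesis using h by (simp add: natural_hom_def ring_iso_def)
  qed
  show ?thesis
  proof (intro conjI allI impI ballI)
    show "\<exists>h. natural_hom k n a b z h" by (rule exI[of _ \<phi>]) (rule \<phi>(2))
  qed (rule natural_hom_unique iso; assumption)+
qed

end
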